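(* Let $G$ be a connected solvable Lie group with Lie algebra $\mathfrak g$, and let $\mathcal X$ be a hyperbolic linear vector field on $G$ with associated derivation $\mathcal D$ and hyperbolic decomposition $\mathfrak g=\mathfrak g^+\oplus\mathfrak g^-$. Let $\mathfrak h^+$ and $\mathfrak h^-$ be the Lie subalgebras generated by the positive and negative control directions, and assume $\mathfrak h=\mathfrak h^+\oplus\mathfrak h^-$ with $\mathfrak h^+\subset\mathfrak g^+$ and $\mathfrak h^-\subset\mathfrak g^-$. Then $$\mathcal D\mathfrak h=\mathcal D^+\mathfrak h^+\oplus\mathcal D^-\mathfrak h^-.$$ Consequently, $\mathcal D\mathfrak h=\mathfrak g$ if and only if $\mathcal D^+\mathfrak h^+=\mathfrak g^+$ and $\mathcal D^-\mathfrak h^-=\mathfrak g^-$.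
   Context: A vector field $\mathcal X$ on $G$ is linear if its flow $(\varphi_t)_{t\in\mathbb R}$ is a one-parameter subgroup of $\operatorname{Aut}(G)$; its associated derivation of $\mathfrak g$ is $\mathcal D(Y)=-[\mathcal X,Y]$. $\mathcal X$ is hyperbolic if $\mathcal D$ has no eigenvalue with zero real part. $\mathfrak g^+$ (resp. $\mathfrak g^-$) is the sum of the (real) generalized eigenspaces of $\mathcal D$ for eigenvalues with positive (resp. negative) real part; these are $\mathcal D$-invariant Lie subalgebras. Put $\mathcal D^\pm=\mathcal D|_{\mathfrak g^\pm}$. The control directions are right-invariant vector fields $X^+_1,\dots,X^+_{m_+}$ with $X^+_\alpha(e)\in\mathfrak g^+$ and $X^-_1,\dots,X^-_{m_-}$ with $X^-_\beta(e)\in\mathfrak g^-$, and $\mathfrak h^\pm$ is the Lie subalgebra generated by $X^\pm_1(e),\dots,X^\pm_{m_\pm}(e)$. Define $$\mathcal D\mathfrak h=\operatorname{span}\{\mathcal D^kY:\ Y\in\mathfrak h,\ k\ge0\},\qquad \mathcal D^\pm\mathfrak h^\pm=\operatorname{span}\{(\mathcal D^\pm)^kY:\ Y\in\mathfrak h^\pm,\ k\ge0\}.$$ *)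

theory Defs
  imports
    "HOL-Analysis.Analysis"
    "HOL-Algebra.Solvable_Groups"
    "HOL-Library.Function_Algebras"
begin

section \<open>Functions as a real vector space\<close>

instantiation "fun" :: (type, real_vector) real_vector
begin

definition scaleR_fun :: "real \<Rightarrow> ('a \<Rightarrow> 'b) \<Rightarrow> 'a \<Rightarrow> 'b" where
  "scaleR_fun c f = (\<lambda>x. c *\<^sub>R f x)"

instance
  by standard (auto simp: scaleR_fun_def fun_eq_iff scaleR_add_right scaleR_add_left)

end


section \<open>Smooth manifolds\<close>

primrec Ck_on :: "nat \<Rightarrow> 'a::real_normed_vector set \<Rightarrow> ('a \<Rightarrow> 'b::real_normed_vector) \<Rightarrow> bool" where
  "Ck_on 0 S f \<longleftrightarrow> continuous_on S f"
| "Ck_on (Suc k) S f \<longleftrightarrow>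
     (\<forall>x\<in>S. f differentiable (at x)) \<and> (\<forall>v. Ck_on k S (\<lambda>x. frechet_derivative f (at x) v))"

definition smooth_on :: "'a::real_normed_vector set \<Rightarrow> ('a \<Rightarrow> 'b::real_normed_vector) \<Rightarrow> bool" where
  "smooth_on S f \<longleftrightarrow> (\<forall>k. Ck_on k S f)"

text \<open>A chart \<open>(U, \<phi>)\<close> consists of its domain and its coordinate map; the values of \<open>\<phi>\<close> off \<open>U\<close>
  are irrelevant, and \<open>inv_into U \<phi>\<close> is the local parametrisation.\<close>

type_synonym ('g, 'e) chart = "'g set \<times> ('g \<Rightarrow> 'e)"

text \<open>The model space is a finite-dimensional inner product space, i.e. some \<open>\<real>\<^sup>n\<close>. The class
  \<open>euclidean_space\<close> is not used since it excludes \<open>n = 0\<close>. The manifold is the whole type \<open>'g\<close>.\<close>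

definition smooth_atlas ::
    "('g::{t2_space,second_countable_topology}, 'e::real_inner) chart set \<Rightarrow> bool" where
  "smooth_atlas A \<longleftrightarrow>
     (\<exists>B::'e set. finite B \<and> span B = UNIV) \<and>
     (\<Union>(U, \<phi>)\<in>A. U) = UNIV \<and>
     (\<forall>(U, \<phi>)\<in>A. open U \<and> open (\<phi> ` U) \<and> homeomorphism U (\<phi> ` U) \<phi> (inv_into U \<phi>)) \<and>
     (\<forall>(U, \<phi>)\<in>A. \<forall>(V, \<psi>)\<in>A. smooth_on (\<phi> ` (U \<inter> V)) (\<psi> \<circ> inv_into U \<phi>))"

definition smooth_map ::
    "('g::topological_space, 'e::real_normed_vector) chart set \<Rightarrow>
     ('h::topological_space, 'f::real_normed_vector) chart set \<Rightarrow> ('g \<Rightarrow> 'h) \<Rightarrow> bool" where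
  "smooth_map A B F \<longleftrightarrow>
     continuous_on UNIV F \<and>
     (\<forall>(U, \<phi>)\<in>A. \<forall>(V, \<psi>)\<in>B. smooth_on (\<phi> ` (U \<inter> F -` V)) (\<psi> \<circ> F \<circ> inv_into U \<phi>))"

definition prod_atlas ::
    "('g, 'e) chart set \<Rightarrow> ('h, 'f) chart set \<Rightarrow> ('g \<times> 'h, 'e \<times> 'f) chart set" where
  "prod_atlas A B = {(U \<times> V, map_prod \<phi> \<psi>) | U \<phi> V \<psi>. (U, \<phi>) \<in> A \<and> (V, \<psi>) \<in> B}"

definition real_atlas :: "(real, real) chart set" where
  "real_atlas = {(UNIV, id)}"

definition smooth_fun ::
    "('g::topological_space, 'e::real_normed_vector) chart set \<Rightarrow> ('g \<Rightarrow> real) \<Rightarrow> bool" where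
  "smooth_fun A f \<longleftrightarrow> smooth_map A real_atlas f"


section \<open>Vector fields\<close>

text \<open>Tangent vectors are the operators \<open>f \<mapsto> \<Sum>\<^sub>i v\<^sub>i \<partial>\<^sub>i f\<close> on smooth functions, in the coordinates of
  some chart. A vector field \<open>X\<close> acts on smooth functions, \<open>X f p\<close> being the derivative
  \<open>X\<^sub>p f\<close>. Both are set to \<open>0\<close> on functions that are not smooth, so that equality of vector fields
  is equality of HOL functions.\<close>

type_synonym 'g operator = "('g \<Rightarrow> real) \<Rightarrow> 'g \<Rightarrow> real"

definition tangent_space ::
    "('g::topological_space, 'e::real_normed_vector) chart set \<Rightarrow> 'g \<Rightarrow> (('g \<Rightarrow> real) \<Rightarrow> real) set" where
  "tangent_space A p =
     {(\<lambda>f. if smooth_fun A f then frechet_derivative (f \<circ> inv_into U \<phi>) (at (\<phi> p)) v else 0)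
       | U \<phi> v. (U, \<phi>) \<in> A \<and> p \<in> U}"

definition vector_field ::
    "('g::topological_space, 'e::real_normed_vector) chart set \<Rightarrow> 'g operator \<Rightarrow> bool" where
  "vector_field A X \<longleftrightarrow>
     (\<forall>p. (\<lambda>f. X f p) \<in> tangent_space A p) \<and> (\<forall>f. smooth_fun A f \<longrightarrow> smooth_fun A (X f))"

definition lie_bracket :: "'g operator \<Rightarrow> 'g operator \<Rightarrow> 'g operator" where
  "lie_bracket X Y = (\<lambda>f. X (Y f) - Y (X f))"

text \<open>A global flow is a smooth action of \<open>\<real>\<close>. That \<open>(t, x) \<mapsto> \<Phi> t x\<close> is smooth holds for the flow
  of every complete smooth vector field.\<close>

definition flow_of ::
    "('g::topological_space, 'e::real_normed_vector) chart set \<Rightarrow> 'g operator \<Rightarrow> (real \<Rightarrow> 'g \<Rightarrow> 'g) \<Rightarrow> bool" where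
  "flow_of A X \<Phi> \<longleftrightarrow>
     smooth_map (prod_atlas real_atlas A) A (\<lambda>(t, x). \<Phi> t x) \<and>
     \<Phi> 0 = id \<and> (\<forall>s t. \<Phi> (s + t) = \<Phi> s \<circ> \<Phi> t) \<and>
     (\<forall>f x t. smooth_fun A f \<longrightarrow> ((\<lambda>s. f (\<Phi> s x)) has_real_derivative X f (\<Phi> t x)) (at t))"


section \<open>Lie groups and linear vector fields\<close>

locale lie_group = group G
  for G :: "'g::{t2_space,second_countable_topology} monoid" (structure)
    and A :: "('g, 'e::real_inner) chart set" +
  assumes carrier_eq: "carrier G = UNIV"
    and atlas: "smooth_atlas A"
    and smooth_mult: "smooth_map (prod_atlas A A) A (\<lambda>(x, y). x \<otimes> y)"
    and smooth_inv: "smooth_map A A (\<lambda>x. inv x)"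

text \<open>The Lie algebra of the group consists of the right-invariant vector fields, identified with
  the tangent space at the identity by evaluation there. Right invariance of \<open>Y\<close> means
  \<open>Y (f \<circ> R\<^sub>h) = (Y f) \<circ> R\<^sub>h\<close> for every right translation \<open>R\<^sub>h\<close>.\<close>

definition lie_algebra ::
    "'g::topological_space monoid \<Rightarrow> ('g, 'e::real_normed_vector) chart set \<Rightarrow> 'g operator set" where
  "lie_algebra G A =
     {Y. vector_field A Y \<and>
       (\<forall>h f. smooth_fun A f \<longrightarrow> Y (\<lambda>x. f (x \<otimes>\<^bsub>G\<^esub> h)) = (\<lambda>x. Y f (x \<otimes>\<^bsub>G\<^esub> h)))}"

definition lie_subalgebra ::
    "'g::topological_space monoid \<Rightarrow> ('g, 'e::real_normed_vector) chart set \<Rightarrow> 'g operator set \<Rightarrow> bool" where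
  "lie_subalgebra G A H \<longleftrightarrow>
     subspace H \<and> H \<subseteq> lie_algebra G A \<and> (\<forall>X\<in>H. \<forall>Y\<in>H. lie_bracket X Y \<in> H)"

definition lie_generated ::
    "'g::topological_space monoid \<Rightarrow> ('g, 'e::real_normed_vector) chart set \<Rightarrow> 'g operator set \<Rightarrow> 'g operator set" where
  "lie_generated G A S = lie_subalgebra G A hull S"

definition lie_automorphisms ::
    "'g::topological_space monoid \<Rightarrow> ('g, 'e::real_normed_vector) chart set \<Rightarrow> ('g \<Rightarrow> 'g) set" where
  "lie_automorphisms G A = {F \<in> iso G G. smooth_map A A F \<and> smooth_map A A (inv_into UNIV F)}"

definition linear_vector_field ::
    "'g::topological_space monoid \<Rightarrow> ('g, 'e::real_normed_vector) chart set \<Rightarrow> 'g operator \<Rightarrow> bool" where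
  "linear_vector_field G A X \<longleftrightarrow>
     vector_field A X \<and> (\<exists>\<Phi>. flow_of A X \<Phi> \<and> (\<forall>t. \<Phi> t \<in> lie_automorphisms G A))"

definition derivation_of :: "'g operator \<Rightarrow> 'g operator \<Rightarrow> 'g operator" where
  "derivation_of X Y = - lie_bracket X Y"


section \<open>Spectral decomposition\<close>

text \<open>Eigenvalues are taken in the complexification: a pair \<open>(u, w)\<close> stands for \<open>u + \<i> w\<close>, and
  \<open>map_prod D D\<close> is the complexification of \<open>D\<close>.\<close>

definition cscale :: "complex \<Rightarrow> 'v::real_vector \<times> 'v \<Rightarrow> 'v \<times> 'v" where
  "cscale l = (\<lambda>(u, w). (Re l *\<^sub>R u - Im l *\<^sub>R w, Im l *\<^sub>R u + Re l *\<^sub>R w))"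

definition eigenvalue_on :: "'v::real_vector set \<Rightarrow> ('v \<Rightarrow> 'v) \<Rightarrow> complex \<Rightarrow> bool" where
  "eigenvalue_on V D l \<longleftrightarrow> (\<exists>z \<in> V \<times> V. z \<noteq> 0 \<and> map_prod D D z = cscale l z)"

definition generalized_eigenspace ::
    "'v::real_vector set \<Rightarrow> ('v \<Rightarrow> 'v) \<Rightarrow> complex \<Rightarrow> ('v \<times> 'v) set" where
  "generalized_eigenspace V D l =
     {z \<in> V \<times> V. \<exists>n. ((\<lambda>y. map_prod D D y - cscale l y) ^^ n) z = 0}"

text \<open>The real parts of the complex generalized eigenvectors for \<open>l\<close>; this is
  \<open>V \<inter> (E\<^sub>l + E\<^sub>\<mu>)\<close> with \<open>\<mu>\<close> the complex conjugate of \<open>l\<close>.\<close>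

definition real_generalized_eigenspace ::
    "'v::real_vector set \<Rightarrow> ('v \<Rightarrow> 'v) \<Rightarrow> complex \<Rightarrow> 'v set" where
  "real_generalized_eigenspace V D l = fst ` generalized_eigenspace V D l"

definition hyperbolic_on :: "'v::real_vector set \<Rightarrow> ('v \<Rightarrow> 'v) \<Rightarrow> bool" where
  "hyperbolic_on V D \<longleftrightarrow> (\<forall>l. eigenvalue_on V D l \<longrightarrow> Re l \<noteq> 0)"

definition unstable_part :: "'v::real_vector set \<Rightarrow> ('v \<Rightarrow> 'v) \<Rightarrow> 'v set" where
  "unstable_part V D =
     span (\<Union>l\<in>{l. eigenvalue_on V D l \<and> Re l > 0}. real_generalized_eigenspace V D l)"

definition stable_part :: "'v::real_vector set \<Rightarrow> ('v \<Rightarrow> 'v) \<Rightarrow> 'v set" where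
  "stable_part V D =
     span (\<Union>l\<in>{l. eigenvalue_on V D l \<and> Re l < 0}. real_generalized_eigenspace V D l)"

definition orbit_span :: "('v::real_vector \<Rightarrow> 'v) \<Rightarrow> 'v set \<Rightarrow> 'v set" where
  "orbit_span D H = span {(D ^^ k) Y | k Y. Y \<in> H}"

definition direct_sum :: "'v::real_vector set \<Rightarrow> 'v set \<Rightarrow> 'v set \<Rightarrow> bool" where
  "direct_sum W U V \<longleftrightarrow> W = {u + v | u v. u \<in> U \<and> v \<in> V} \<and> U \<inter> V = {0}"

end

(* The derivation D preserves the Lie algebra g: the flow of X consists of automorphisms, so X obeys a
   Leibniz rule with respect to the product of G, and the symmetry of mixed partial derivatives turns
   it into right invariance of [X, Y]. A right-invariant field is determined by its value at the
   identity, so g is finite-dimensional. Bezout's identity for complex polynomials in D on the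
   complexification then yields g = g+ + g- (primary decomposition, no eigenvalue on the imaginary
   axis) as well as the directness of this sum. Both summands are D-invariant, hence D^k acts
   separately on h+ and h-, and comparing components gives the equivalence. *)

theory Submission
  imports Defs
    "HOL-Computational_Algebra.Fundamental_Theorem_Algebra"
    "HOL-Computational_Algebra.Polynomial_Factorial"
    "HOL-Computational_Algebra.Field_as_Ring"
begin

section \<open>Calculus of iterated directional derivatives\<close>

section \<open>Functions of class Ck\<close>

text \<open>A vector field is additive only on smooth functions, so \<open>derivation_of X\<close>
  is known to be linear only on vector fields, not on the type of all operators. The spectral
  argument therefore runs with a globally linear map that agrees with it on the Lie algebra, and the
  spectral notions and orbit spans are shown to depend on the values there alone.

  Tangent vectors are by definition directional derivatives in a chart. A product rule for
  \<open>[X, Y]\<close> would thus not yet make it a vector field: a direction has to be exhibited.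
  It is found at the identity, where \<open>X\<close> vanishes, as the velocity of the linearised
  flow applied to the value of \<open>Y\<close>, and is carried elsewhere by right translations.

  Annihilating polynomials are attached to single vectors. Finite dimension enters the decomposition
  only as a linear dependence among the iterates of one vector, so pairs of real vectors with an
  action of complex polynomials can stand in for a complex vector space.\<close>

lemma Ck_on_cong:
  assumes "open S" and "\<And>x. x \<in> S \<Longrightarrow> f x = g x" and "Ck_on k S f"
  shows "Ck_on k S g"
  using assms(2,3)
proof (induction k arbitrary: f g)
  case 0
  then show ?case by (simp cong: continuous_on_cong)
next
  case (Suc k)
  \<comment> \<open>\<open>Ck_on\<close> takes derivatives \<open>at x\<close>, not within
    \<open>S\<close>; agreement on \<open>S\<close> transfers them because \<open>S\<close> is
    open.\<close>
  have deriv: "(g has_derivative frechet_derivative f (at x)) (at x)" if "x \<in> S" for x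
  proof -
    have "(f has_derivative frechet_derivative f (at x)) (at x)"
      using Suc.prems(2) that by (simp add: frechet_derivative_works)
    then show ?thesis
      by (rule has_derivative_transform_within_open[OF _ \<open>open S\<close> that Suc.prems(1)])
  qed
  have "Ck_on k S (\<lambda>x. frechet_derivative g (at x) v)" for v
    by (rule Suc.IH[of "\<lambda>x. frechet_derivative f (at x) v"])
      (use Suc.prems(2) frechet_derivative_at[OF deriv] in auto)
  then show ?case using deriv by (auto simp: differentiable_def)
qed

lemma Ck_on_SucI:
  assumes "open S"
    and deriv: "\<And>x. x \<in> S \<Longrightarrow> (f has_derivative f' x) (at x)"
    and Ck: "\<And>v. Ck_on k S (\<lambda>x. f' x v)"
  shows "Ck_on (Suc k) S f"
proof -
  have "Ck_on k S (\<lambda>x. frechet_derivative f (at x) v)" for v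
    by (rule Ck_on_cong[OF \<open>open S\<close> _ Ck[of v]]) (simp add: frechet_derivative_at[OF deriv])
  then show ?thesis using deriv by (auto simp: differentiable_def)
qed

lemma Ck_on_continuous_on: "Ck_on k S f \<Longrightarrow> continuous_on S f"
  by (cases k)
    (auto intro!: continuous_at_imp_continuous_on differentiable_imp_continuous_within)

lemma Ck_on_subset: "Ck_on k S f \<Longrightarrow> T \<subseteq> S \<Longrightarrow> Ck_on k T f"
  by (induction k arbitrary: f) (auto intro: continuous_on_subset)

lemma Ck_on_SucD: "Ck_on (Suc k) S f \<Longrightarrow> Ck_on k S f"
proof (induction k arbitrary: f)
  case 0
  then show ?case unfolding Ck_on.simps(1) by (rule Ck_on_continuous_on)
next
  case (Suc k)
  have "Ck_on k S (\<lambda>x. frechet_derivative f (at x) v)" for v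
    by (rule Suc.IH) (use Suc.prems in simp)
  then show ?case using Suc.prems by simp
qed

text \<open>A composite of maps between manifolds has no single middle chart; its regularity is
  established near each point and then glued.\<close>

lemma Ck_on_locally:
  assumes "\<And>x. x \<in> S \<Longrightarrow> \<exists>T. open T \<and> x \<in> T \<and> Ck_on k T f"
  shows "Ck_on k S f"
  using assms
proof (induction k arbitrary: f)
  case (0 f)
  have "isCont f x" if x: "x \<in> S" for x
  proof -
    obtain T where "open T" "x \<in> T" "continuous_on T f" using 0[OF x] by auto
    then show ?thesis by (simp add: continuous_on_eq_continuous_at)
  qed
  then show ?case by (simp add: continuous_at_imp_continuous_on)
next
  case (Suc k)
  have "Ck_on k S (\<lambda>x. frechet_derivative f (at x) v)" for v
  proof (rule Suc.IH)
    fix x assume "x \<in> S"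
    then show "\<exists>T. open T \<and> x \<in> T \<and> Ck_on k T (\<lambda>x. frechet_derivative f (at x) v)"
      using Suc.prems[of x] by auto
  qed
  moreover have "f differentiable (at x)" if "x \<in> S" for x using Suc.prems[OF that] by auto
  ultimately show ?case by simp
qed

lemma Ck_on_const: "Ck_on k S (\<lambda>x. c)"
  by (induction k arbitrary: c) simp_all

lemma Ck_on_add:
  assumes "open S" "Ck_on k S f" "Ck_on k S g"
  shows "Ck_on k S (\<lambda>x. f x + g x)"
  using assms(2,3)
proof (induction k arbitrary: f g)
  case 0
  then show ?case by (simp add: continuous_on_add)
next
  case (Suc k)
  show ?case
  proof (rule Ck_on_SucI[OF \<open>open S\<close>])
    show "((\<lambda>x. f x + g x) has_derivative
        (\<lambda>v. frechet_derivative f (at x) v + frechet_derivative g (at x) v)) (at x)"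
      if "x \<in> S" for x
      using Suc.prems that by (intro has_derivative_add) (simp_all add: frechet_derivative_works)
    show "Ck_on k S (\<lambda>x. frechet_derivative f (at x) v + frechet_derivative g (at x) v)" for v
      using Suc.prems by (intro Suc.IH) simp_all
  qed
qed

lemma Ck_on_sum:
  assumes "open S" "\<And>i. i \<in> I \<Longrightarrow> Ck_on k S (f i)"
  shows "Ck_on k S (\<lambda>x. \<Sum>i\<in>I. f i x)"
  using assms(2)
  by (induction I rule: infinite_finite_induct) (auto intro: Ck_on_add[OF \<open>open S\<close>] Ck_on_const)

lemma Ck_on_bounded_linear:
  assumes "open S" "Ck_on k S f" and L: "bounded_linear L"
  shows "Ck_on k S (\<lambda>x. L (f x))"
  using assms(2)
proof (induction k arbitrary: f)
  case 0
  then show ?case by (simp add: bounded_linear.continuous_on[OF L])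
next
  case (Suc k)
  show ?case
  proof (rule Ck_on_SucI[OF \<open>open S\<close>])
    show "((\<lambda>x. L (f x)) has_derivative (\<lambda>v. L (frechet_derivative f (at x) v))) (at x)"
      if "x \<in> S" for x
      using Suc.prems that
      by (intro bounded_linear.has_derivative[OF L]) (simp add: frechet_derivative_works)
    show "Ck_on k S (\<lambda>x. L (frechet_derivative f (at x) v))" for v
      using Suc.prems by (intro Suc.IH) simp
  qed
qed

lemma Ck_on_Pair:
  assumes "open S" "Ck_on k S f" "Ck_on k S g"
  shows "Ck_on k S (\<lambda>x. (f x, g x))"
proof -
  have "bounded_linear (\<lambda>x::'b. (x, 0::'c))" "bounded_linear (\<lambda>x::'c. (0::'b, x))"
    by (intro bounded_linear_Pair bounded_linear_ident bounded_linear_zero)+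
  then have "Ck_on k S (\<lambda>x. (f x, 0) + (0, g x))"
    by (intro Ck_on_add[OF assms(1)] Ck_on_bounded_linear[OF assms(1,2)]
        Ck_on_bounded_linear[OF assms(1,3)])
  then show ?thesis by simp
qed

lemma Ck_on_scaleR:
  fixes c :: "'a::real_normed_vector \<Rightarrow> real"
  assumes "open S" "Ck_on k S c" "Ck_on k S f"
  shows "Ck_on k S (\<lambda>x. c x *\<^sub>R f x)"
  using assms(2,3)
proof (induction k arbitrary: c f)
  case 0
  then show ?case by (simp add: continuous_on_scaleR)
next
  case (Suc k)
  show ?case
  proof (rule Ck_on_SucI[OF \<open>open S\<close>])
    show "((\<lambda>x. c x *\<^sub>R f x) has_derivative
        (\<lambda>v. c x *\<^sub>R frechet_derivative f (at x) v + frechet_derivative c (at x) v *\<^sub>R f x)) (at x)"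
      if "x \<in> S" for x
      using Suc.prems that by (intro has_derivative_scaleR) (simp_all add: frechet_derivative_works)
    show "Ck_on k S (\<lambda>x. c x *\<^sub>R frechet_derivative f (at x) v + frechet_derivative c (at x) v *\<^sub>R f x)" for v
      using Suc.prems Ck_on_SucD[of k S c] Ck_on_SucD[of k S f]
      by (intro Ck_on_add[OF \<open>open S\<close>]; intro Suc.IH) simp_all
  qed
qed

text \<open>The derivative of the composite in direction \<open>v\<close> is the derivative of
  \<open>f\<close> in the fixed direction \<open>L v\<close>, again composed with the affine map, so
  the induction closes without a basis. It serves the identity of the reals and the projections of
  products.\<close>

lemma Ck_on_affine:
  assumes "open S" "Ck_on k T f" and L: "bounded_linear L" and T: "\<And>x. x \<in> S \<Longrightarrow> c + L x \<in> T"
  shows "Ck_on k S (\<lambda>x. f (c + L x))"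
  using assms(2)
proof (induction k arbitrary: f)
  case 0
  have "continuous_on S (\<lambda>x. c + L x)"
    by (intro continuous_intros bounded_linear.continuous_on[OF L])
  from continuous_on_compose2[OF _ this, of T f] show ?case using 0 T by auto
next
  case (Suc k)
  show ?case
  proof (rule Ck_on_SucI[OF \<open>open S\<close>])
    fix x assume "x \<in> S"
    have "((\<lambda>x. c + L x) has_derivative L) (at x)"
      using has_derivative_add[OF has_derivative_const[of c "at x"] bounded_linear_imp_has_derivative[OF L, of "at x"]]
      by simp
    moreover have "(f has_derivative frechet_derivative f (at (c + L x))) (at (c + L x))"
      using Suc.prems T[OF \<open>x \<in> S\<close>] by (simp add: frechet_derivative_works)
    ultimately show "((\<lambda>x. f (c + L x)) has_derivative
        (\<lambda>v. frechet_derivative f (at (c + L x)) (L v))) (at x)"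
      by (rule has_derivative_compose[where f = "\<lambda>x. c + L x" and g = f])
  next
    show "Ck_on k S (\<lambda>x. frechet_derivative f (at (c + L x)) (L v))" for v
      using Suc.prems by (intro Suc.IH) simp
  qed
qed

text \<open>Orthogonality makes the coordinates inner products, hence bounded linear in
  \<open>x\<close>, as \<open>Ck_on_compose\<close> requires. The residual is orthogonal to the
  whole space, hence to itself.\<close>

lemma orthogonal_expansion:
  fixes B :: "'a::real_inner set"
  assumes "finite B" "span B = UNIV"
  obtains C where "finite C" "\<And>x::'a. x = (\<Sum>b\<in>C. ((x \<bullet> b) / (b \<bullet> b)) *\<^sub>R b)"
proof -
  obtain C where C: "finite C" "span C = (UNIV::'a set)" "pairwise orthogonal C"
    using basis_orthogonal[OF assms(1)] assms(2) by metis
  show thesis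
  proof (rule that[OF C(1)])
    fix x :: 'a
    define y where "y = x - (\<Sum>b\<in>C. ((x \<bullet> b) / (b \<bullet> b)) *\<^sub>R b)"
    have orth: "y \<bullet> a = 0" if "a \<in> C" for a
    proof -
      \<comment> \<open>For \<open>b = a = 0\<close> both sides are \<open>0\<close>, so a zero
        vector in \<open>C\<close> does no harm.\<close>
      have "(\<Sum>b\<in>C. ((x \<bullet> b) / (b \<bullet> b)) * (b \<bullet> a)) = (\<Sum>b\<in>C. if b = a then x \<bullet> a else 0)"
      proof (rule sum.cong[OF refl])
        fix b assume "b \<in> C"
        then show "((x \<bullet> b) / (b \<bullet> b)) * (b \<bullet> a) = (if b = a then x \<bullet> a else 0)"
          using pairwiseD[OF C(3), of b a] that by (auto simp: orthogonal_def)
      qed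
      then show ?thesis using C(1) that by (simp add: y_def inner_diff_left inner_sum_left)
    qed
    have "y \<bullet> a = 0" if "a \<in> span C" for a
      using that by (induction rule: span_induct_alt) (simp_all add: inner_add_right orth)
    then have "y \<bullet> y = 0" using C(2) by simp
    then show "x = (\<Sum>b\<in>C. ((x \<bullet> b) / (b \<bullet> b)) *\<^sub>R b)" by (simp add: y_def)
  qed
qed

text \<open>Partial derivatives of \<open>f\<close> are only known to be regular direction by direction, so the
  chain rule has to be expanded in a basis of the middle space.\<close>

lemma Ck_on_compose:
  fixes g :: "'a::real_normed_vector \<Rightarrow> 'b::real_inner"
  assumes B: "finite B" "span B = (UNIV :: 'b set)" and "open S"
    and "Ck_on k T f" "Ck_on k S g" and T: "g ` S \<subseteq> T"
  shows "Ck_on k S (\<lambda>x. f (g x))"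
proof -
  obtain C where C: "finite C" "\<And>x::'b. x = (\<Sum>b\<in>C. ((x \<bullet> b) / (b \<bullet> b)) *\<^sub>R b)"
    using orthogonal_expansion[OF B] by blast
  from assms(4,5) show ?thesis
  proof (induction k arbitrary: f)
    case 0
    then show ?case using T continuous_on_compose2[of T f S g] by simp
  next
    case (Suc k)
    let ?f' = "\<lambda>x. frechet_derivative f (at x)" and ?g' = "\<lambda>x. frechet_derivative g (at x)"
    show ?case
    proof (rule Ck_on_SucI[OF \<open>open S\<close>])
      fix x assume x: "x \<in> S"
      then have f: "(f has_derivative ?f' (g x)) (at (g x))"
        using Suc.prems(1) T by (auto simp: frechet_derivative_works)
      have "(g has_derivative ?g' x) (at x)"
        using Suc.prems(2) x by (simp add: frechet_derivative_works)
      then have "((\<lambda>x. f (g x)) has_derivative (\<lambda>v. ?f' (g x) (?g' x v))) (at x)"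
        using f by (rule has_derivative_compose[where f = g and g = f])
      also have "(\<lambda>v. ?f' (g x) (?g' x v)) =
          (\<lambda>v. \<Sum>b\<in>C. ((?g' x v \<bullet> b) / (b \<bullet> b)) *\<^sub>R ?f' (g x) b)"
      proof
        fix v
        have "?f' (g x) (?g' x v) = ?f' (g x) (\<Sum>b\<in>C. ((?g' x v \<bullet> b) / (b \<bullet> b)) *\<^sub>R b)"
          by (rule arg_cong[OF C(2)])
        then show "?f' (g x) (?g' x v) = (\<Sum>b\<in>C. ((?g' x v \<bullet> b) / (b \<bullet> b)) *\<^sub>R ?f' (g x) b)"
          using has_derivative_linear[OF f] by (simp add: linear_sum linear_scale)
      qed
      finally show "((\<lambda>x. f (g x)) has_derivative
          (\<lambda>v. \<Sum>b\<in>C. ((?g' x v \<bullet> b) / (b \<bullet> b)) *\<^sub>R ?f' (g x) b)) (at x)" .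
    next
      fix v
      have "Ck_on k S (\<lambda>x. ((?g' x v \<bullet> b) / (b \<bullet> b)) *\<^sub>R ?f' (g x) b)" for b
      proof (intro Ck_on_scaleR \<open>open S\<close>)
        have "bounded_linear (\<lambda>y. (y \<bullet> b) / (b \<bullet> b))"
          by (rule bounded_linear_compose[OF bounded_linear_divide bounded_linear_inner_left])
        then show "Ck_on k S (\<lambda>x. (?g' x v \<bullet> b) / (b \<bullet> b))"
          by (rule Ck_on_bounded_linear[OF \<open>open S\<close>, rotated]) (use Suc.prems(2) in simp)
        \<comment> \<open>The outer function is arbitrary in the induction: here it is the
          derivative of \<open>f\<close> in the fixed direction \<open>b\<close>.\<close>
        show "Ck_on k S (\<lambda>x. ?f' (g x) b)"
          by (rule Suc.IH[OF _ Ck_on_SucD[OF Suc.prems(2)]]) (use Suc.prems(1) in simp)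
      qed
      then show "Ck_on k S (\<lambda>x. \<Sum>b\<in>C. ((?g' x v \<bullet> b) / (b \<bullet> b)) *\<^sub>R ?f' (g x) b)"
        by (intro Ck_on_sum \<open>open S\<close>)
    qed
  qed
qed

section \<open>Symmetry of mixed second derivatives\<close>

lemma has_real_derivative_along_line:
  fixes f :: "'a::real_normed_vector \<Rightarrow> real"
  assumes "f differentiable (at (x + s *\<^sub>R v))"
  shows "((\<lambda>s. f (x + s *\<^sub>R v)) has_real_derivative frechet_derivative f (at (x + s *\<^sub>R v)) v) (at s)"
proof -
  have f: "(f has_derivative frechet_derivative f (at (x + s *\<^sub>R v))) (at (x + s *\<^sub>R v))"
    using assms by (simp add: frechet_derivative_works)
  have "((\<lambda>s. x + s *\<^sub>R v) has_derivative (\<lambda>r. r *\<^sub>R v)) (at s)"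
    by (auto intro!: derivative_eq_intros)
  from has_derivative_compose[where f = "\<lambda>s. x + s *\<^sub>R v" and g = f, OF this f] show ?thesis
    using linear_scale[OF has_derivative_linear[OF f]]
    by (simp add: has_field_derivative_def mult.commute[of _ "frechet_derivative f (at (x + s *\<^sub>R v)) v"])
qed

text \<open>The mean value theorem is applied in direction \<open>v\<close> and then in direction
  \<open>w\<close>. The second difference is symmetric in \<open>v\<close> and \<open>w\<close>,
  this evaluation of it is not; that contrast yields
  \<open>frechet_derivative_commute\<close>.\<close>

lemma second_difference:
  fixes f :: "'a::real_normed_vector \<Rightarrow> real"
  assumes "Ck_on 2 S f" and h: "h > 0"
    and S: "\<And>s t. \<lbrakk>0 \<le> s; s \<le> h; 0 \<le> t; t \<le> h\<rbrakk> \<Longrightarrow> x + s *\<^sub>R v + t *\<^sub>R w \<in> S"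
  obtains s t where "0 < s" "s < h" "0 < t" "t < h"
    "f (x + h *\<^sub>R v + h *\<^sub>R w) - f (x + h *\<^sub>R v) - (f (x + h *\<^sub>R w) - f x) =
      h * (h * frechet_derivative (\<lambda>y. frechet_derivative f (at y) v) (at (x + s *\<^sub>R v + t *\<^sub>R w)) w)"
proof -
  let ?fv = "\<lambda>y. frechet_derivative f (at y) v"
  have diff: "f differentiable (at y)" "?fv differentiable (at y)" if "y \<in> S" for y
    using assms(1) that by (simp_all add: numeral_2_eq_2)
  have line: "((\<lambda>s. f (x + c *\<^sub>R w + s *\<^sub>R v)) has_real_derivative ?fv (x + c *\<^sub>R w + s *\<^sub>R v)) (at s)"
    if "0 \<le> s" "s \<le> h" "0 \<le> c" "c \<le> h" for s c
    using S[OF that] by (intro has_real_derivative_along_line diff(1)) (simp add: algebra_simps)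
  \<comment> \<open>The term \<open>0 *\<^sub>R w\<close> makes both summands instances of
    \<open>line\<close>.\<close>
  let ?\<phi> = "\<lambda>s. f (x + h *\<^sub>R w + s *\<^sub>R v) - f (x + 0 *\<^sub>R w + s *\<^sub>R v)"
  have "(?\<phi> has_real_derivative (?fv (x + h *\<^sub>R w + s *\<^sub>R v) - ?fv (x + 0 *\<^sub>R w + s *\<^sub>R v))) (at s)"
    if "0 \<le> s" "s \<le> h" for s
    using that h by (intro DERIV_diff line) auto
  from MVT2[OF h this] obtain s where s: "0 < s" "s < h"
    "?\<phi> h - ?\<phi> 0 = h * (?fv (x + h *\<^sub>R w + s *\<^sub>R v) - ?fv (x + 0 *\<^sub>R w + s *\<^sub>R v))"
    by auto
  have "((\<lambda>t. ?fv (x + s *\<^sub>R v + t *\<^sub>R w)) has_real_derivative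
      frechet_derivative ?fv (at (x + s *\<^sub>R v + t *\<^sub>R w)) w) (at t)" if "0 \<le> t" "t \<le> h" for t
    using s that by (intro has_real_derivative_along_line diff(2) S) auto
  from MVT2[OF h this] obtain t where t: "0 < t" "t < h"
    "?fv (x + s *\<^sub>R v + h *\<^sub>R w) - ?fv (x + s *\<^sub>R v + 0 *\<^sub>R w) =
      h * frechet_derivative ?fv (at (x + s *\<^sub>R v + t *\<^sub>R w)) w"
    by auto
  show thesis
    using s t by (intro that[of s t]) (simp_all add: add.commute add.left_commute)
qed

text \<open>Two evaluations of one second difference make the mixed derivatives take equal values at
  points arbitrarily near \<open>x\<close>; continuity then rules out a gap at
  \<open>x\<close>.\<close>

lemma frechet_derivative_commute:
  fixes f :: "'a::real_normed_vector \<Rightarrow> real"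
  assumes f: "Ck_on 2 S f" and "open S" "x \<in> S"
  shows "frechet_derivative (\<lambda>y. frechet_derivative f (at y) v) (at x) w =
    frechet_derivative (\<lambda>y. frechet_derivative f (at y) w) (at x) v"
proof (rule ccontr)
  define D2 where "D2 = (\<lambda>v w x. frechet_derivative (\<lambda>y. frechet_derivative f (at y) v) (at x) w)"
  assume "\<not> ?thesis"
  then have e: "\<bar>D2 v w x - D2 w v x\<bar> > 0" by (simp add: D2_def)
  have "continuous_on S (D2 a b)" for a b
    using f unfolding D2_def by (simp add: numeral_2_eq_2)
  then have cont: "isCont (D2 a b) x" for a b
    using \<open>open S\<close> \<open>x \<in> S\<close> continuous_on_eq_continuous_at by blast
  have "\<exists>d>0. \<forall>y. dist y x < d \<longrightarrow> \<bar>D2 a b y - D2 a b x\<bar> < \<bar>D2 v w x - D2 w v x\<bar> / 2" for a b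
    using cont[of a b, unfolded continuous_at_eps_delta, rule_format, OF half_gt_zero[OF e]]
    by (simp add: dist_real_def)
  then obtain d1 d2 where d1: "d1 > 0"
      "\<And>y. dist y x < d1 \<Longrightarrow> \<bar>D2 v w y - D2 v w x\<bar> < \<bar>D2 v w x - D2 w v x\<bar> / 2"
    and d2: "d2 > 0"
      "\<And>y. dist y x < d2 \<Longrightarrow> \<bar>D2 w v y - D2 w v x\<bar> < \<bar>D2 v w x - D2 w v x\<bar> / 2"
    by meson
  obtain d3 where d3: "d3 > 0" "ball x d3 \<subseteq> S"
    using \<open>open S\<close> \<open>x \<in> S\<close> open_contains_ball by blast
  define d where "d = min d1 (min d2 d3)"
  \<comment> \<open>With this \<open>h\<close> the whole parallelogram lies within \<open>d\<close>
    of \<open>x\<close>; the \<open>1\<close> keeps the denominator positive when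
    \<open>v = w = 0\<close>.\<close>
  define h where "h = d / (norm v + norm w + 1)"
  have "d > 0" using d1 d2 d3 by (simp add: d_def)
  then have "h > 0" by (simp add: h_def add_nonneg_pos)
  \<comment> \<open>The condition on the norms admits both orders, \<open>(v, w)\<close> and
    \<open>(w, v)\<close>.\<close>
  have near: "dist (x + s *\<^sub>R a + t *\<^sub>R b) x < d"
    if "0 \<le> s" "s \<le> h" "0 \<le> t" "t \<le> h" "norm a + norm b = norm v + norm w" for s t a b
  proof -
    have "dist (x + s *\<^sub>R a + t *\<^sub>R b) x = norm (s *\<^sub>R a + t *\<^sub>R b)" by (simp add: dist_norm algebra_simps)
    also have "\<dots> \<le> s * norm a + t * norm b" using that by (intro norm_triangle_le) simp
    also have "\<dots> \<le> h * norm a + h * norm b" using that by (intro add_mono mult_right_mono) auto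
    also have "\<dots> = h * (norm v + norm w)" using that(5) by (simp add: distrib_left[symmetric])
    also have "\<dots> < h * (norm v + norm w + 1)" using \<open>h > 0\<close> by simp
    also have "\<dots> = d" by (simp add: h_def add_nonneg_pos less_imp_neq[symmetric])
    finally show ?thesis .
  qed
  have in_S: "y \<in> S" if "dist y x < d" for y
    using that d3(2) by (auto simp: d_def dist_commute)
  have difference: "\<exists>s t. 0 < s \<and> s < h \<and> 0 < t \<and> t < h \<and>
      f (x + h *\<^sub>R a + h *\<^sub>R b) - f (x + h *\<^sub>R a) - (f (x + h *\<^sub>R b) - f x) =
      h * (h * D2 a b (x + s *\<^sub>R a + t *\<^sub>R b))"
    if ab: "norm a + norm b = norm v + norm w" for a b
  proof (rule second_difference[OF f \<open>h > 0\<close>])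
    show "x + s *\<^sub>R a + t *\<^sub>R b \<in> S" if "0 \<le> s" "s \<le> h" "0 \<le> t" "t \<le> h" for s t
      by (rule in_S[OF near[OF that ab]])
  qed (unfold D2_def, blast)
  obtain s t where st: "0 < s" "s < h" "0 < t" "t < h"
    "f (x + h *\<^sub>R v + h *\<^sub>R w) - f (x + h *\<^sub>R v) - (f (x + h *\<^sub>R w) - f x) =
      h * (h * D2 v w (x + s *\<^sub>R v + t *\<^sub>R w))"
    using difference[of v w] by blast
  obtain s' t' where st': "0 < s'" "s' < h" "0 < t'" "t' < h"
    "f (x + h *\<^sub>R w + h *\<^sub>R v) - f (x + h *\<^sub>R w) - (f (x + h *\<^sub>R v) - f x) =
      h * (h * D2 w v (x + s' *\<^sub>R w + t' *\<^sub>R v))"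
    using difference[of w v] by (auto simp: add.commute)
  have "h * (h * D2 v w (x + s *\<^sub>R v + t *\<^sub>R w)) = h * (h * D2 w v (x + s' *\<^sub>R w + t' *\<^sub>R v))"
    unfolding st(5)[symmetric] st'(5)[symmetric] by (simp add: algebra_simps)
  then have eq: "D2 v w (x + s *\<^sub>R v + t *\<^sub>R w) = D2 w v (x + s' *\<^sub>R w + t' *\<^sub>R v)" using \<open>h > 0\<close> by simp
  have "dist (x + s *\<^sub>R v + t *\<^sub>R w) x < d1" "dist (x + s' *\<^sub>R w + t' *\<^sub>R v) x < d2"
    using near[of s t v w] near[of s' t' w v] st st' by (auto simp: d_def)
  then have "\<bar>D2 v w (x + s *\<^sub>R v + t *\<^sub>R w) - D2 v w x\<bar> < \<bar>D2 v w x - D2 w v x\<bar> / 2"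
    "\<bar>D2 w v (x + s' *\<^sub>R w + t' *\<^sub>R v) - D2 w v x\<bar> < \<bar>D2 v w x - D2 w v x\<bar> / 2"
    using d1(2) d2(2) by blast+
  \<comment> \<open>With \<open>p\<close> the common value and \<open>q\<close>, \<open>r\<close>
    the two derivatives at \<open>x\<close>, the gap would be smaller than the sum of its two
    halves.\<close>
  moreover have "\<bar>q - r\<bar> \<le> \<bar>p - q\<bar> + \<bar>p - r\<bar>" for p q r :: real by simp
  ultimately show False
    unfolding eq by (smt (verit) field_sum_of_halves)
qed

text \<open>\<open>K\<close> will be a function moved by the flow, read in a chart of the group and
  in time. Exchanging the time derivative with the space derivative is symmetry in the directions
  \<open>(v, 0)\<close> and \<open>(0, 1)\<close>.\<close>

lemma partial_derivatives_commute:
  fixes K :: "'a::real_normed_vector \<times> real \<Rightarrow> real"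
  assumes K: "Ck_on 2 (S \<times> UNIV) K" and "open S" "x0 \<in> S"
    and a: "\<And>x. x \<in> S \<Longrightarrow> ((\<lambda>t. K (x, t)) has_real_derivative a x) (at 0)"
  shows "((\<lambda>t. frechet_derivative (\<lambda>x. K (x, t)) (at x0) v) has_real_derivative
    frechet_derivative a (at x0) v) (at 0)"
proof -
  let ?K' = "\<lambda>w z. frechet_derivative K (at z) w"
  have SU: "open (S \<times> (UNIV::real set))" using \<open>open S\<close> by (intro open_Times) auto
  have diff: "K differentiable (at (x, t))" "?K' w differentiable (at (x, t))" if "x \<in> S" for x t w
    using K that by (cases w; simp add: numeral_2_eq_2)+
  have embed: "((\<lambda>x. (x, t)) has_derivative (\<lambda>v. (v, 0))) (at x)" for x :: 'a and t :: real
    by (intro has_derivative_Pair has_derivative_ident has_derivative_const)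
  have "a x = ?K' (0, 1) (x, 0)" if "x \<in> S" for x
  proof -
    have "((\<lambda>s. K ((x, 0) + s *\<^sub>R (0, 1))) has_real_derivative
        ?K' (0, 1) ((x, 0) + 0 *\<^sub>R (0, 1))) (at 0)"
      using diff(1)[OF that] by (intro has_real_derivative_along_line) simp
    then show ?thesis using DERIV_unique[OF a[OF that]] by simp
  qed
  note a_eq = this
  have "((\<lambda>x. ?K' (0, 1) (x, 0)) has_derivative
      (\<lambda>v. frechet_derivative (?K' (0, 1)) (at (x0, 0)) (v, 0))) (at x0)"
    using diff(2)[OF \<open>x0 \<in> S\<close>] unfolding frechet_derivative_works
    by (rule has_derivative_compose[OF embed, where g = "?K' (0, 1)"])
  then have "(a has_derivative (\<lambda>v. frechet_derivative (?K' (0, 1)) (at (x0, 0)) (v, 0))) (at x0)"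
    using \<open>open S\<close> \<open>x0 \<in> S\<close> by (rule has_derivative_transform_within_open) (simp add: a_eq)
  then have "frechet_derivative a (at x0) v = frechet_derivative (?K' (0, 1)) (at (x0, 0)) (v, 0)"
    by (simp add: frechet_derivative_at[symmetric])
  also have "\<dots> = frechet_derivative (?K' (v, 0)) (at (x0, 0)) (0, 1)"
    using K SU \<open>x0 \<in> S\<close> by (intro frechet_derivative_commute) auto
  finally have 1: "frechet_derivative a (at x0) v = frechet_derivative (?K' (v, 0)) (at (x0, 0)) (0, 1)" .
  have 2: "frechet_derivative (\<lambda>x. K (x, t)) (at x0) v = ?K' (v, 0) (x0, t)" for t
  proof -
    have "((\<lambda>x. K (x, t)) has_derivative (\<lambda>v. ?K' (v, 0) (x0, t))) (at x0)"
      using diff(1)[OF \<open>x0 \<in> S\<close>] unfolding frechet_derivative_works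
      by (rule has_derivative_compose[OF embed, where g = K])
    then show ?thesis by (simp add: frechet_derivative_at[symmetric])
  qed
  have "((\<lambda>t. ?K' (v, 0) ((x0, 0) + t *\<^sub>R (0, 1))) has_real_derivative
      frechet_derivative (?K' (v, 0)) (at ((x0, 0) + 0 *\<^sub>R (0, 1))) (0, 1)) (at 0)"
    using diff(2)[OF \<open>x0 \<in> S\<close>] by (intro has_real_derivative_along_line) simp
  then show ?thesis unfolding 1 2 by simp
qed

section \<open>Charts and product atlases\<close>

section \<open>Smooth maps\<close>

text \<open>\<open>smooth_atlas\<close> without the compatibility of charts. Composition of smooth
  maps asks for this much, and it passes to product atlases without computing coordinate
  changes.\<close>

definition charted :: "('g::topological_space, 'e::real_inner) chart set \<Rightarrow> bool" where
  "charted A \<longleftrightarrow>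
     (\<exists>B::'e set. finite B \<and> span B = UNIV) \<and> (\<Union>(U, \<phi>)\<in>A. U) = UNIV \<and>
     (\<forall>(U, \<phi>)\<in>A. open U \<and> open (\<phi> ` U) \<and> homeomorphism U (\<phi> ` U) \<phi> (inv_into U \<phi>))"

lemma charted_smooth_atlas: "smooth_atlas A \<Longrightarrow> charted A"
  by (simp add: smooth_atlas_def charted_def)

lemma charted_obtain_basis:
  fixes A :: "('g::topological_space, 'e::real_inner) chart set"
  assumes "charted A"
  obtains B :: "'e set" where "finite B" "span B = UNIV"
  using assms unfolding charted_def by blast

lemma charted_obtain_chart:
  assumes "charted A"
  obtains U \<phi> where "(U, \<phi>) \<in> A" "p \<in> U"
proof -
  have "p \<in> (\<Union>(U, \<phi>)\<in>A. U)" using assms by (simp add: charted_def)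
  then show thesis using that by auto
qed

context
  fixes A :: "('g::topological_space, 'e::real_inner) chart set" and U \<phi>
  assumes A: "charted A" and U: "(U, \<phi>) \<in> A"
begin

lemma chart_open: "open U" "open (\<phi> ` U)"
  using A U unfolding charted_def by blast+

lemma chart_homeomorphism: "homeomorphism U (\<phi> ` U) \<phi> (inv_into U \<phi>)"
  using A U unfolding charted_def by blast

lemma chart_inv_into [simp]: "x \<in> U \<Longrightarrow> inv_into U \<phi> (\<phi> x) = x"
  using chart_homeomorphism by (simp add: homeomorphism_def)

lemma chart_inj_on: "inj_on \<phi> U"
  by (rule inj_on_inverseI) (rule chart_inv_into)

lemma chart_open_image:
  assumes "open W"
  shows "open (\<phi> ` (U \<inter> W))"
proof -
  have "open (\<phi> ` U \<inter> inv_into U \<phi> -` W)"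
    using chart_homeomorphism chart_open(2) assms
    by (intro continuous_open_preimage) (auto simp: homeomorphism_def)
  moreover have "\<phi> ` U \<inter> inv_into U \<phi> -` W = \<phi> ` (U \<inter> W)" by auto
  ultimately show ?thesis by simp
qed

end

lemma charted_real_atlas: "charted real_atlas"
proof -
  have "span {1::real} = UNIV" by (auto simp: span_singleton)
  then show ?thesis
    unfolding charted_def real_atlas_def
    by (auto intro!: exI[of _ "{1::real}"] simp: homeomorphism_def)
qed

text \<open>Charts of \<open>prod_atlas\<close> are inverted by \<open>inv_into\<close> of the
  product map itself; injectivity of the factors splits it into the two local inverses.\<close>

lemma inv_into_map_prod:
  assumes "inj_on \<phi> U" "inj_on \<psi> V" "x \<in> U" "y \<in> V"
  shows "inv_into (U \<times> V) (map_prod \<phi> \<psi>) (\<phi> x, \<psi> y) = (x, y)"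
proof -
  have "inj_on (map_prod \<phi> \<psi>) (U \<times> V)" using assms(1,2) by (rule map_prod_inj_on)
  then have "inv_into (U \<times> V) (map_prod \<phi> \<psi>) (map_prod \<phi> \<psi> (x, y)) = (x, y)"
    using assms(3,4) by (intro inv_into_f_f) auto
  then show ?thesis by simp
qed

lemma prod_atlasE:
  assumes "(W, \<omega>) \<in> prod_atlas A B"
  obtains U \<phi> V \<psi> where "(U, \<phi>) \<in> A" "(V, \<psi>) \<in> B" "W = U \<times> V" "\<omega> = map_prod \<phi> \<psi>"
  using assms unfolding prod_atlas_def by blast

lemma prod_atlasI: "(U, \<phi>) \<in> A \<Longrightarrow> (V, \<psi>) \<in> B \<Longrightarrow> (U \<times> V, map_prod \<phi> \<psi>) \<in> prod_atlas A B"
  unfolding prod_atlas_def by blast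

lemma continuous_on_map_prod:
  assumes "continuous_on S f" "continuous_on T g"
  shows "continuous_on (S \<times> T) (map_prod f g)"
proof -
  have "continuous_on (S \<times> T) (\<lambda>z. f (fst z))"
    by (rule continuous_on_compose2[OF assms(1) continuous_on_fst[OF continuous_on_id]]) auto
  moreover have "continuous_on (S \<times> T) (\<lambda>z. g (snd z))"
    by (rule continuous_on_compose2[OF assms(2) continuous_on_snd[OF continuous_on_id]]) auto
  ultimately show ?thesis by (simp add: map_prod_def case_prod_beta' continuous_on_Pair)
qed

lemma charted_prod_atlas:
  fixes A :: "('g::topological_space, 'e::real_inner) chart set"
    and B :: "('h::topological_space, 'f::real_inner) chart set"
  assumes A: "charted A" and B: "charted B"
  shows "charted (prod_atlas A B)"
  unfolding charted_def
proof (intro conjI)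
  obtain C :: "'e set" and C' :: "'f set" where C: "finite C" "span C = UNIV" "finite C'" "span C' = UNIV"
    by (metis charted_obtain_basis[OF A] charted_obtain_basis[OF B])
  let ?C = "(\<lambda>x. (x, 0)) ` C \<union> (\<lambda>y. (0, y)) ` C'"
  have "(x, y) \<in> span ?C" for x y
  proof -
    have "linear (\<lambda>x::'e. (x, 0::'f))" "linear (\<lambda>y::'f. (0::'e, y))" by (auto intro!: linearI)
    then have "(x, 0) \<in> span ((\<lambda>x. (x, 0::'f)) ` C)" "(0, y) \<in> span ((\<lambda>y. (0::'e, y)) ` C')"
      using C by (simp_all add: linear_span_image)
    moreover have "span ((\<lambda>x. (x, 0)) ` C) \<subseteq> span ?C" "span ((\<lambda>y. (0, y)) ` C') \<subseteq> span ?C"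
      by (intro span_mono Un_upper1 Un_upper2)+
    ultimately have "(x, 0) + (0, y) \<in> span ?C" by (blast intro: span_add)
    then show ?thesis by simp
  qed
  then have "span ?C = UNIV" by auto
  moreover have "finite ?C" using C by simp
  ultimately show "\<exists>B::('e \<times> 'f) set. finite B \<and> span B = UNIV" by blast
next
  have "(x, y) \<in> (\<Union>(U, \<phi>)\<in>prod_atlas A B. U)" for x y
  proof -
    obtain U \<phi> V \<psi> where "(U, \<phi>) \<in> A" "x \<in> U" "(V, \<psi>) \<in> B" "y \<in> V"
      by (metis charted_obtain_chart[OF A, of x] charted_obtain_chart[OF B, of y])
    then have "(U \<times> V, map_prod \<phi> \<psi>) \<in> prod_atlas A B" "(x, y) \<in> U \<times> V"
      by (simp_all add: prod_atlasI)
    then show ?thesis by blast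
  qed
  then show "(\<Union>(U, \<phi>)\<in>prod_atlas A B. U) = UNIV" by auto
next
  have "open W \<and> open (\<omega> ` W) \<and> homeomorphism W (\<omega> ` W) \<omega> (inv_into W \<omega>)"
    if "(W, \<omega>) \<in> prod_atlas A B" for W \<omega>
  proof -
    from that obtain U \<phi> V \<psi> where U: "(U, \<phi>) \<in> A" and V: "(V, \<psi>) \<in> B"
      and W: "W = U \<times> V" "\<omega> = map_prod \<phi> \<psi>" by (rule prod_atlasE)
    note hU = chart_homeomorphism[OF A U] and hV = chart_homeomorphism[OF B V]
    have img: "\<omega> ` W = \<phi> ` U \<times> \<psi> ` V" by (auto simp: W)
    have inv: "inv_into W \<omega> z = (inv_into U \<phi> (fst z), inv_into V \<psi> (snd z))" if "z \<in> \<omega> ` W" for z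
    proof -
      from that obtain x y where "x \<in> U" "y \<in> V" "z = (\<phi> x, \<psi> y)" by (auto simp: W)
      then show ?thesis
        using inv_into_map_prod[OF chart_inj_on[OF A U] chart_inj_on[OF B V]]
          chart_inv_into[OF A U] chart_inv_into[OF B V] by (simp add: W)
    qed
    have "homeomorphism W (\<omega> ` W) \<omega> (inv_into W \<omega>)"
    proof (rule homeomorphismI)
      show "continuous_on W \<omega>"
        unfolding W using hU hV by (intro continuous_on_map_prod) (simp_all add: homeomorphism_def)
      have "continuous_on (\<phi> ` U \<times> \<psi> ` V) (map_prod (inv_into U \<phi>) (inv_into V \<psi>))"
        using hU hV by (intro continuous_on_map_prod) (simp_all add: homeomorphism_def)
      then show "continuous_on (\<omega> ` W) (inv_into W \<omega>)"
        unfolding img[symmetric] by (rule continuous_on_eq) (simp add: inv map_prod_def case_prod_beta')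
      show "inv_into W \<omega> ` (\<omega> ` W) \<subseteq> W"
        by (intro image_subsetI inv_into_into)
      show "inv_into W \<omega> (\<omega> z) = z" if "z \<in> W" for z
        using that inv_into_map_prod[OF chart_inj_on[OF A U] chart_inj_on[OF B V]] by (auto simp: W)
      show "\<omega> (inv_into W \<omega> z) = z" if "z \<in> \<omega> ` W" for z
        using that by (rule f_inv_into_f)
    qed simp
    moreover have "open W" "open (\<omega> ` W)"
      unfolding img using chart_open[OF A U] chart_open[OF B V] by (auto simp: W intro: open_Times)
    ultimately show ?thesis by simp
  qed
  then show "\<forall>(U, \<phi>)\<in>prod_atlas A B. open U \<and> open (\<phi> ` U) \<and> homeomorphism U (\<phi> ` U) \<phi> (inv_into U \<phi>)"
    by auto
qed

section \<open>Smooth maps between manifolds\<close>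

lemma smooth_mapI:
  assumes "continuous_on UNIV F"
    and "\<And>U \<phi> V \<psi> k. (U, \<phi>) \<in> A \<Longrightarrow> (V, \<psi>) \<in> B \<Longrightarrow>
      Ck_on k (\<phi> ` (U \<inter> F -` V)) (\<lambda>x. \<psi> (F (inv_into U \<phi> x)))"
  shows "smooth_map A B F"
  using assms unfolding smooth_map_def smooth_on_def by (auto simp: o_def)

lemma smooth_map_continuous: "smooth_map A B F \<Longrightarrow> continuous_on UNIV F"
  by (simp add: smooth_map_def)

lemma smooth_map_Ck:
  assumes "smooth_map A B F" "(U, \<phi>) \<in> A" "(V, \<psi>) \<in> B"
  shows "Ck_on k (\<phi> ` (U \<inter> F -` V)) (\<lambda>x. \<psi> (F (inv_into U \<phi> x)))"
  using assms unfolding smooth_map_def smooth_on_def by (fastforce simp: o_def)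

lemma smooth_map_open_vimage: "smooth_map A B F \<Longrightarrow> open V \<Longrightarrow> open (F -` V)"
  using smooth_map_continuous open_vimage by blast

lemma smooth_map_compose:
  fixes B :: "('h::topological_space, 'f::real_inner) chart set"
  assumes A: "charted A" and B: "charted B" and C: "charted C"
    and F: "smooth_map A B F" and G: "smooth_map B C G"
  shows "smooth_map A C (\<lambda>x. G (F x))"
proof (rule smooth_mapI)
  show "continuous_on UNIV (\<lambda>x. G (F x))"
    by (rule continuous_on_compose2[OF smooth_map_continuous[OF G] smooth_map_continuous[OF F]]) simp
next
  fix U \<phi> W \<omega> k assume U: "(U, \<phi>) \<in> A" and W: "(W, \<omega>) \<in> C"
  obtain D :: "'f set" where D: "finite D" "span D = UNIV" using charted_obtain_basis[OF B] by blast
  show "Ck_on k (\<phi> ` (U \<inter> (\<lambda>x. G (F x)) -` W)) (\<lambda>x. \<omega> (G (F (inv_into U \<phi> x))))"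
  proof (rule Ck_on_locally)
    fix y assume "y \<in> \<phi> ` (U \<inter> (\<lambda>x. G (F x)) -` W)"
    then obtain x where x: "x \<in> U" "G (F x) \<in> W" "y = \<phi> x" by blast
    obtain V \<psi> where V: "(V, \<psi>) \<in> B" "F x \<in> V" using charted_obtain_chart[OF B] by blast
    \<comment> \<open>Coordinates of the points that \<open>F\<close> sends into the middle chart
      \<open>V\<close> and \<open>G\<close> from there into \<open>W\<close>; open by
      continuity.\<close>
    let ?T = "\<phi> ` (U \<inter> F -` (V \<inter> G -` W))"
    have T: "open ?T"
      by (intro chart_open_image[OF A U] smooth_map_open_vimage[OF F] open_Int chart_open(1)[OF B V(1)]
          smooth_map_open_vimage[OF G] chart_open(1)[OF C W])
    have "Ck_on k ?T (\<lambda>z. (\<lambda>u. \<omega> (G (inv_into V \<psi> u))) (\<psi> (F (inv_into U \<phi> z))))"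
    proof (rule Ck_on_compose[OF D T smooth_map_Ck[OF G V(1) W]])
      show "Ck_on k ?T (\<lambda>z. \<psi> (F (inv_into U \<phi> z)))"
        by (rule Ck_on_subset[OF smooth_map_Ck[OF F U V(1)]]) blast
      show "(\<lambda>z. \<psi> (F (inv_into U \<phi> z))) ` ?T \<subseteq> \<psi> ` (V \<inter> G -` W)"
        using chart_inv_into[OF A U] by auto
    qed
    then have "Ck_on k ?T (\<lambda>z. \<omega> (G (F (inv_into U \<phi> z))))"
      by (rule Ck_on_cong[OF T, rotated]) (auto simp: chart_inv_into[OF A U] chart_inv_into[OF B V(1)])
    moreover have "y \<in> ?T" using x V by blast
    ultimately show "\<exists>T. open T \<and> y \<in> T \<and> Ck_on k T (\<lambda>z. \<omega> (G (F (inv_into U \<phi> z))))"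
      using T by blast
  qed
qed

lemma smooth_map_Pair:
  assumes A: "charted A" and B: "charted B" and C: "charted C"
    and F: "smooth_map A B F" and G: "smooth_map A C G"
  shows "smooth_map A (prod_atlas B C) (\<lambda>x. (F x, G x))"
proof (rule smooth_mapI)
  show "continuous_on UNIV (\<lambda>x. (F x, G x))"
    by (intro continuous_on_Pair smooth_map_continuous[OF F] smooth_map_continuous[OF G])
next
  fix U \<phi> W \<omega> k assume U: "(U, \<phi>) \<in> A" and "(W, \<omega>) \<in> prod_atlas B C"
  then obtain V \<psi> V' \<psi>' where V: "(V, \<psi>) \<in> B" "(V', \<psi>') \<in> C" "W = V \<times> V'" "\<omega> = map_prod \<psi> \<psi>'"
    using prod_atlasE by metis
  have "open (\<phi> ` (U \<inter> (F -` V \<inter> G -` V')))"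
    by (intro chart_open_image[OF A U] open_Int smooth_map_open_vimage[OF F] smooth_map_open_vimage[OF G]
        chart_open(1)[OF B V(1)] chart_open(1)[OF C V(2)])
  moreover have "U \<inter> (F -` V \<inter> G -` V') = U \<inter> (\<lambda>x. (F x, G x)) -` W" using V by auto
  ultimately have "open (\<phi> ` (U \<inter> (\<lambda>x. (F x, G x)) -` W))" by simp
  then have "Ck_on k (\<phi> ` (U \<inter> (\<lambda>x. (F x, G x)) -` W))
      (\<lambda>x. (\<psi> (F (inv_into U \<phi> x)), \<psi>' (G (inv_into U \<phi> x))))"
  proof (rule Ck_on_Pair)
    show "Ck_on k (\<phi> ` (U \<inter> (\<lambda>x. (F x, G x)) -` W)) (\<lambda>x. \<psi> (F (inv_into U \<phi> x)))"
      by (rule Ck_on_subset[OF smooth_map_Ck[OF F U V(1)]]) (use V in auto)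
    show "Ck_on k (\<phi> ` (U \<inter> (\<lambda>x. (F x, G x)) -` W)) (\<lambda>x. \<psi>' (G (inv_into U \<phi> x)))"
      by (rule Ck_on_subset[OF smooth_map_Ck[OF G U V(2)]]) (use V in auto)
  qed
  then show "Ck_on k (\<phi> ` (U \<inter> (\<lambda>x. (F x, G x)) -` W)) (\<lambda>x. \<omega> (F (inv_into U \<phi> x), G (inv_into U \<phi> x)))"
    by (simp add: V(4))
qed

text \<open>This is the compatibility of charts in disguise; the projections from products take it
  in this form.\<close>

lemma smooth_map_ident:
  assumes "smooth_atlas A"
  shows "smooth_map A A (\<lambda>x. x)"
proof (rule smooth_mapI)
  fix U \<phi> V \<psi> k assume "(U, \<phi>) \<in> A" "(V, \<psi>) \<in> A"
  then have "smooth_on (\<phi> ` (U \<inter> V)) (\<psi> \<circ> inv_into U \<phi>)"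
    using assms unfolding smooth_atlas_def by blast
  then show "Ck_on k (\<phi> ` (U \<inter> (\<lambda>x. x) -` V)) (\<lambda>x. \<psi> (inv_into U \<phi> x))"
    by (simp add: smooth_on_def o_def)
qed (rule continuous_on_id)

lemma smooth_map_real_ident: "smooth_map real_atlas real_atlas (\<lambda>x. x)"
proof (rule smooth_mapI)
  have "Ck_on k UNIV (\<lambda>x::real. (\<lambda>x. x) (0 + x))" for k
  proof (rule Ck_on_affine[OF open_UNIV _ bounded_linear_ident])
    show "Ck_on k UNIV (\<lambda>x::real. x)" by (cases k) (simp_all add: Ck_on_const)
  qed simp
  then show "Ck_on k (\<phi> ` (U \<inter> (\<lambda>x. x) -` V)) (\<lambda>x. \<psi> (inv_into U \<phi> x))"
    if "(U, \<phi>) \<in> real_atlas" "(V, \<psi>) \<in> real_atlas" for U \<phi> V \<psi> k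
    using that by (simp add: real_atlas_def)
qed (rule continuous_on_id)

lemma smooth_map_const: "smooth_map A B (\<lambda>x. c)"
  by (rule smooth_mapI) (simp_all add: Ck_on_const)

text \<open>In product charts the projection is the linear \<open>fst\<close> followed by a
  coordinate change of \<open>A\<close>, which is smooth by the assumption on the identity.\<close>

lemma smooth_map_fst:
  assumes A: "charted A" "smooth_map A A (\<lambda>x. x)" and B: "charted B"
  shows "smooth_map (prod_atlas A B) A fst"
proof (rule smooth_mapI)
  fix W \<omega> V \<psi> k assume "(W, \<omega>) \<in> prod_atlas A B" and V: "(V, \<psi>) \<in> A"
  then obtain U \<phi> U' \<phi>' where U: "(U, \<phi>) \<in> A" "(U', \<phi>') \<in> B" "W = U \<times> U'" "\<omega> = map_prod \<phi> \<phi>'"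
    using prod_atlasE by metis
  have "W \<inter> fst -` V = (U \<inter> V) \<times> U'" using U by auto
  then have img: "\<omega> ` (W \<inter> fst -` V) = \<phi> ` (U \<inter> V) \<times> \<phi>' ` U'" using U by auto
  have S: "open (\<omega> ` (W \<inter> fst -` V))"
    unfolding img by (intro open_Times chart_open_image[OF A(1) U(1)] chart_open[OF B U(2)] chart_open[OF A(1) V])
  have "Ck_on k (\<omega> ` (W \<inter> fst -` V)) (\<lambda>z. (\<lambda>x. \<psi> (inv_into U \<phi> x)) (0 + fst z))"
    using smooth_map_Ck[OF A(2) U(1) V, of k]
    by (rule Ck_on_affine[OF S _ bounded_linear_fst]) (auto simp: img)
  then show "Ck_on k (\<omega> ` (W \<inter> fst -` V)) (\<lambda>z. \<psi> (fst (inv_into W \<omega> z)))"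
  proof (rule Ck_on_cong[OF S, rotated])
    fix z assume "z \<in> \<omega> ` (W \<inter> fst -` V)"
    then obtain x y where "x \<in> U" "y \<in> U'" "z = (\<phi> x, \<phi>' y)" using U by auto
    then show "\<psi> (inv_into U \<phi> (0 + fst z)) = \<psi> (fst (inv_into W \<omega> z))"
      using inv_into_map_prod[OF chart_inj_on[OF A(1) U(1)] chart_inj_on[OF B U(2)]] U
        chart_inv_into[OF A(1) U(1)] by simp
  qed
qed (intro continuous_on_fst continuous_on_id)

lemma smooth_map_snd:
  assumes A: "charted A" and B: "charted B" "smooth_map B B (\<lambda>x. x)"
  shows "smooth_map (prod_atlas A B) B snd"
proof (rule smooth_mapI)
  fix W \<omega> V \<psi> k assume "(W, \<omega>) \<in> prod_atlas A B" and V: "(V, \<psi>) \<in> B"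
  then obtain U \<phi> U' \<phi>' where U: "(U, \<phi>) \<in> A" "(U', \<phi>') \<in> B" "W = U \<times> U'" "\<omega> = map_prod \<phi> \<phi>'"
    using prod_atlasE by metis
  have "W \<inter> snd -` V = U \<times> (U' \<inter> V)" using U by auto
  then have img: "\<omega> ` (W \<inter> snd -` V) = \<phi> ` U \<times> \<phi>' ` (U' \<inter> V)" using U by auto
  have S: "open (\<omega> ` (W \<inter> snd -` V))"
    unfolding img by (intro open_Times chart_open_image[OF B(1) U(2)] chart_open[OF A U(1)] chart_open[OF B(1) V])
  have "Ck_on k (\<omega> ` (W \<inter> snd -` V)) (\<lambda>z. (\<lambda>x. \<psi> (inv_into U' \<phi>' x)) (0 + snd z))"
    using smooth_map_Ck[OF B(2) U(2) V, of k]
    by (rule Ck_on_affine[OF S _ bounded_linear_snd]) (auto simp: img)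
  then show "Ck_on k (\<omega> ` (W \<inter> snd -` V)) (\<lambda>z. \<psi> (snd (inv_into W \<omega> z)))"
  proof (rule Ck_on_cong[OF S, rotated])
    fix z assume "z \<in> \<omega> ` (W \<inter> snd -` V)"
    then obtain x y where "x \<in> U" "y \<in> U'" "z = (\<phi> x, \<phi>' y)" using U by auto
    then show "\<psi> (inv_into U' \<phi>' (0 + snd z)) = \<psi> (snd (inv_into W \<omega> z))"
      using inv_into_map_prod[OF chart_inj_on[OF A U(1)] chart_inj_on[OF B(1) U(2)]] U
        chart_inv_into[OF B(1) U(2)] by simp
  qed
qed (intro continuous_on_snd continuous_on_id)

section \<open>Smooth real functions\<close>

lemma smooth_fun_Ck:
  assumes "smooth_fun A f" "(U, \<phi>) \<in> A"
  shows "Ck_on k (\<phi> ` U) (f \<circ> inv_into U \<phi>)"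
  using smooth_map_Ck[of A real_atlas f U \<phi> UNIV id k] assms
  by (simp add: smooth_fun_def real_atlas_def o_def)

lemma smooth_funI:
  assumes "continuous_on UNIV f"
    and "\<And>U \<phi> k. (U, \<phi>) \<in> A \<Longrightarrow> Ck_on k (\<phi> ` U) (f \<circ> inv_into U \<phi>)"
  shows "smooth_fun A f"
  unfolding smooth_fun_def
  by (rule smooth_mapI) (use assms in \<open>auto simp: real_atlas_def o_def\<close>)

lemma smooth_fun_continuous: "smooth_fun A f \<Longrightarrow> continuous_on UNIV f"
  unfolding smooth_fun_def by (rule smooth_map_continuous)

lemma smooth_fun_zero: "smooth_fun A 0"
  by (rule smooth_funI) (simp_all add: zero_fun_def o_def Ck_on_const)

lemma smooth_fun_add:
  assumes A: "charted A" and "smooth_fun A f" "smooth_fun A g"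
  shows "smooth_fun A (f + g)"
proof (rule smooth_funI)
  show "continuous_on UNIV (f + g)"
    unfolding plus_fun_def by (intro continuous_on_add smooth_fun_continuous[OF assms(2)] smooth_fun_continuous[OF assms(3)])
next
  fix U \<phi> k assume U: "(U, \<phi>) \<in> A"
  show "Ck_on k (\<phi> ` U) ((f + g) \<circ> inv_into U \<phi>)"
    using Ck_on_add[OF chart_open(2)[OF A U] smooth_fun_Ck[OF assms(2) U] smooth_fun_Ck[OF assms(3) U]]
    by (simp add: o_def)
qed

lemma smooth_fun_scaleR:
  assumes A: "charted A" and "smooth_fun A f"
  shows "smooth_fun A (c *\<^sub>R f)"
proof (rule smooth_funI)
  show "continuous_on UNIV (c *\<^sub>R f)"
    unfolding scaleR_fun_def by (intro continuous_on_scaleR continuous_on_const smooth_fun_continuous[OF assms(2)])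
next
  fix U \<phi> k assume U: "(U, \<phi>) \<in> A"
  show "Ck_on k (\<phi> ` U) ((c *\<^sub>R f) \<circ> inv_into U \<phi>)"
    using Ck_on_scaleR[OF chart_open(2)[OF A U] Ck_on_const smooth_fun_Ck[OF assms(2) U]]
    by (simp add: o_def scaleR_fun_def)
qed

lemma smooth_fun_diff:
  assumes A: "charted A" and "smooth_fun A f" "smooth_fun A g"
  shows "smooth_fun A (f - g)"
  using smooth_fun_add[OF A assms(2) smooth_fun_scaleR[OF A assms(3), of "-1"]] by simp

lemma smooth_fun_compose:
  assumes "charted A" "charted B" "smooth_map A B F" "smooth_fun B f"
  shows "smooth_fun A (\<lambda>x. f (F x))"
  using smooth_map_compose[OF assms(1,2) charted_real_atlas assms(3)] assms(4) by (simp add: smooth_fun_def)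

text \<open>Space enters through a chart and time as itself, the form in which
  \<open>partial_derivatives_commute\<close> takes its \<open>K\<close>.\<close>

lemma smooth_fun_prod_real:
  assumes B: "charted B" and f: "smooth_fun (prod_atlas B real_atlas) f" and U: "(U, \<phi>) \<in> B"
  shows "Ck_on k (\<phi> ` U \<times> UNIV) (\<lambda>(x, t). f (inv_into U \<phi> x, t))"
proof -
  have R: "(UNIV, id) \<in> real_atlas" by (simp add: real_atlas_def)
  have img: "map_prod \<phi> id ` (U \<times> (UNIV::real set)) = \<phi> ` U \<times> UNIV"
    by (auto simp: map_prod_def image_iff)
  have S: "open (\<phi> ` U \<times> (UNIV::real set))" by (intro open_Times chart_open(2)[OF B U] open_UNIV)
  have "Ck_on k (\<phi> ` U \<times> UNIV) (f \<circ> inv_into (U \<times> UNIV) (map_prod \<phi> id))"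
    using smooth_fun_Ck[OF f prod_atlasI[OF U R], of k] unfolding img .
  then show ?thesis
  proof (rule Ck_on_cong[OF S, rotated])
    fix z :: "'b \<times> real" assume "z \<in> \<phi> ` U \<times> UNIV"
    then obtain x t where "x \<in> U" "z = (\<phi> x, id t)" by auto
    then show "(f \<circ> inv_into (U \<times> UNIV) (map_prod \<phi> id)) z = (case z of (x, t) \<Rightarrow> f (inv_into U \<phi> x, t))"
      using inv_into_map_prod[OF chart_inj_on[OF B U], of id UNIV x t] chart_inv_into[OF B U]
      by simp
  qed
qed

section \<open>Tangent vectors and right-invariant vector fields\<close>

lemma Ck_on_has_derivative:
  "Ck_on (Suc k) S f \<Longrightarrow> x \<in> S \<Longrightarrow> (f has_derivative frechet_derivative f (at x)) (at x)"
  by (simp add: frechet_derivative_works)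

text \<open>The generic element of \<open>tangent_space\<close>, named so that linearity in the
  direction \<open>v\<close> can be stated.\<close>

definition tangent_vector ::
    "('g::topological_space, 'e::real_normed_vector) chart set \<Rightarrow> 'g set \<Rightarrow> ('g \<Rightarrow> 'e) \<Rightarrow> 'g \<Rightarrow> 'e \<Rightarrow> ('g \<Rightarrow> real) \<Rightarrow> real"
  where "tangent_vector A U \<phi> p v =
    (\<lambda>f. if smooth_fun A f then frechet_derivative (f \<circ> inv_into U \<phi>) (at (\<phi> p)) v else 0)"

lemma tangent_space_altdef:
  "tangent_space A p = {tangent_vector A U \<phi> p v | U \<phi> v. (U, \<phi>) \<in> A \<and> p \<in> U}"
  by (simp add: tangent_space_def tangent_vector_def)

lemma smooth_fun_has_derivative:
  assumes "smooth_fun A f" "(U, \<phi>) \<in> A" "p \<in> U"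
  shows "((f \<circ> inv_into U \<phi>) has_derivative frechet_derivative (f \<circ> inv_into U \<phi>) (at (\<phi> p))) (at (\<phi> p))"
  using smooth_fun_Ck[OF assms(1,2), of 1] assms(3) by (simp add: frechet_derivative_works)

text \<open>The chain rule in charts. With the identity as \<open>F\<close> it changes coordinates
  of tangent vectors, with a right translation it transports them along the group, with a flow map
  it gives the linearised flow.\<close>

lemma frechet_derivative_push_forward:
  assumes A: "charted A" and B: "charted B" and F: "smooth_map A B F"
    and U: "(U, \<phi>) \<in> A" "p \<in> U" and V: "(V, \<psi>) \<in> B" "F p \<in> V" and f: "smooth_fun B f"
  shows "frechet_derivative ((\<lambda>x. f (F x)) \<circ> inv_into U \<phi>) (at (\<phi> p)) v =
    frechet_derivative (f \<circ> inv_into V \<psi>) (at (\<psi> (F p)))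
      (frechet_derivative (\<lambda>x. \<psi> (F (inv_into U \<phi> x))) (at (\<phi> p)) v)"
proof -
  let ?g = "\<lambda>x. \<psi> (F (inv_into U \<phi> x))" and ?T = "\<phi> ` (U \<inter> F -` V)"
  have T: "open ?T"
    by (intro chart_open_image[OF A U(1)] smooth_map_open_vimage[OF F] chart_open(1)[OF B V(1)])
  have p: "\<phi> p \<in> ?T" using U V by blast
  have "(?g has_derivative frechet_derivative ?g (at (\<phi> p))) (at (\<phi> p))"
    by (rule Ck_on_has_derivative[OF smooth_map_Ck[OF F U(1) V(1)] p])
  moreover have "((f \<circ> inv_into V \<psi>) has_derivative frechet_derivative (f \<circ> inv_into V \<psi>) (at (\<psi> (F p)))) (at (?g (\<phi> p)))"
    using smooth_fun_has_derivative[OF f V] by (simp add: chart_inv_into[OF A U])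
  ultimately have "((\<lambda>x. (f \<circ> inv_into V \<psi>) (?g x)) has_derivative
      (\<lambda>v. frechet_derivative (f \<circ> inv_into V \<psi>) (at (\<psi> (F p))) (frechet_derivative ?g (at (\<phi> p)) v))) (at (\<phi> p))"
    by (rule has_derivative_compose[where f = ?g and g = "f \<circ> inv_into V \<psi>"])
  then have "(((\<lambda>x. f (F x)) \<circ> inv_into U \<phi>) has_derivative
      (\<lambda>v. frechet_derivative (f \<circ> inv_into V \<psi>) (at (\<psi> (F p))) (frechet_derivative ?g (at (\<phi> p)) v))) (at (\<phi> p))"
    by (rule has_derivative_transform_within_open[OF _ T p])
      (auto simp: chart_inv_into[OF A U(1)] chart_inv_into[OF B V(1)])
  from frechet_derivative_at[OF this] show ?thesis by metis
qed

lemma linear_tangent_vector: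
  assumes "(U, \<phi>) \<in> A" "p \<in> U"
  shows "linear (tangent_vector A U \<phi> p)"
  by (rule linearI)
    (auto simp: tangent_vector_def fun_eq_iff scaleR_fun_def
      linear_add[OF has_derivative_linear[OF smooth_fun_has_derivative[OF _ assms]]]
      linear_scale[OF has_derivative_linear[OF smooth_fun_has_derivative[OF _ assms]]])

text \<open>\<open>tangent_space\<close> lets the chart vary; push-forward along the identity
  converts every direction to one fixed chart. The tangent space is thereby the image of a linear
  map.\<close>

lemma tangent_space_eq_range:
  assumes A: "smooth_atlas A" and V: "(V, \<psi>) \<in> A" "p \<in> V"
  shows "tangent_space A p = range (tangent_vector A V \<psi> p)"
proof
  show "range (tangent_vector A V \<psi> p) \<subseteq> tangent_space A p"
    using V unfolding tangent_space_altdef by blast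
  show "tangent_space A p \<subseteq> range (tangent_vector A V \<psi> p)"
  proof
    fix L assume "L \<in> tangent_space A p"
    then obtain U \<phi> v where U: "(U, \<phi>) \<in> A" "p \<in> U" and L: "L = tangent_vector A U \<phi> p v"
      unfolding tangent_space_altdef by blast
    have "L = tangent_vector A V \<psi> p (frechet_derivative (\<lambda>x. \<psi> (inv_into U \<phi> x)) (at (\<phi> p)) v)"
      using frechet_derivative_push_forward[OF charted_smooth_atlas[OF A] charted_smooth_atlas[OF A]
          smooth_map_ident[OF A] U V]
      by (auto simp: L tangent_vector_def)
    then show "L \<in> range (tangent_vector A V \<psi> p)" by blast
  qed
qed

lemma subspace_tangent_space:
  assumes A: "smooth_atlas A"
  shows "subspace (tangent_space A p)"
proof -
  obtain U \<phi> where U: "(U, \<phi>) \<in> A" "p \<in> U"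
    using charted_obtain_chart[OF charted_smooth_atlas[OF A]] by blast
  show ?thesis
    unfolding tangent_space_eq_range[OF A U]
    by (rule linear_subspace_image[OF linear_tangent_vector[OF U] subspace_UNIV])
qed

lemma tangent_space_apply:
  assumes "L \<in> tangent_space A p"
  shows "\<not> smooth_fun A f \<Longrightarrow> L f = 0"
    and "smooth_fun A f \<Longrightarrow> smooth_fun A g \<Longrightarrow> charted A \<Longrightarrow> L (f + g) = L f + L g"
    and "smooth_fun A f \<Longrightarrow> charted A \<Longrightarrow> L (c *\<^sub>R f) = c * L f"
proof -
  from assms obtain U \<phi> v where U: "(U, \<phi>) \<in> A" "p \<in> U" and L: "L = tangent_vector A U \<phi> p v"
    unfolding tangent_space_altdef by blast
  show "L f = 0" if "\<not> smooth_fun A f" using that by (simp add: L tangent_vector_def)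
  show "L (f + g) = L f + L g" if f: "smooth_fun A f" and g: "smooth_fun A g" and A: "charted A"
  proof -
    have "(f + g) \<circ> inv_into U \<phi> = (\<lambda>x. (f \<circ> inv_into U \<phi>) x + (g \<circ> inv_into U \<phi>) x)" by auto
    then show ?thesis
      using frechet_derivative_at[OF has_derivative_add[OF smooth_fun_has_derivative[OF f U]
          smooth_fun_has_derivative[OF g U]], symmetric] f g smooth_fun_add[OF A f g]
      by (simp add: L tangent_vector_def)
  qed
  show "L (c *\<^sub>R f) = c * L f" if f: "smooth_fun A f" and A: "charted A"
  proof -
    have "(c *\<^sub>R f) \<circ> inv_into U \<phi> = (\<lambda>x. c *\<^sub>R (f \<circ> inv_into U \<phi>) x)" by (auto simp: scaleR_fun_def)
    then show ?thesis
      using frechet_derivative_at[OF has_derivative_scaleR_right[OF smooth_fun_has_derivative[OF f U], of c],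
          symmetric] f smooth_fun_scaleR[OF A f]
      by (simp add: L tangent_vector_def)
  qed
qed

section \<open>Vector fields as operators\<close>

lemma vector_field_tangent: "vector_field A X \<Longrightarrow> (\<lambda>f. X f p) \<in> tangent_space A p"
  by (simp add: vector_field_def)

lemma vector_field_not_smooth:
  fixes A :: "('g::topological_space, 'e::real_inner) chart set"
  assumes "vector_field A X" "\<not> smooth_fun A f"
  shows "X f = 0"
  using tangent_space_apply(1)[OF vector_field_tangent[OF assms(1)] assms(2)] by (simp add: fun_eq_iff)

text \<open>This holds for every \<open>f\<close>: on functions that are not smooth a field takes
  the default \<open>0\<close>, which is smooth.\<close>

lemma smooth_fun_vector_field:
  fixes A :: "('g::topological_space, 'e::real_inner) chart set"
  assumes "vector_field A X"
  shows "smooth_fun A (X f)"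
proof (cases "smooth_fun A f")
  case True
  then show ?thesis using assms by (simp add: vector_field_def)
next
  case False
  then show ?thesis using vector_field_not_smooth[OF assms] by (simp add: smooth_fun_zero)
qed

lemma vector_field_add:
  assumes "charted A" "vector_field A X" "smooth_fun A f" "smooth_fun A g"
  shows "X (f + g) = X f + X g"
  using tangent_space_apply(2)[OF vector_field_tangent[OF assms(2)] assms(3,4,1)]
  by (simp add: fun_eq_iff)

lemma vector_field_scaleR:
  assumes "charted A" "vector_field A X" "smooth_fun A f"
  shows "X (c *\<^sub>R f) = c *\<^sub>R X f"
  using tangent_space_apply(3)[OF vector_field_tangent[OF assms(2)] assms(3,1)]
  by (simp add: fun_eq_iff scaleR_fun_def)

lemma vector_field_zero:
  assumes "charted A" "vector_field A X"
  shows "X 0 = 0"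
  using vector_field_scaleR[OF assms smooth_fun_zero, of 0] by simp

lemma vector_field_diff:
  assumes "charted A" "vector_field A X" "smooth_fun A f" "smooth_fun A g"
  shows "X (f - g) = X f - X g"
  using vector_field_add[OF assms(1-3) smooth_fun_scaleR[OF assms(1,4), of "-1"]]
    vector_field_scaleR[OF assms(1,2,4), of "-1"] by simp

lemma subspace_vector_fields:
  assumes A: "smooth_atlas A"
  shows "subspace {X. vector_field A X}"
proof -
  note T = subspace_tangent_space[OF A] and A' = charted_smooth_atlas[OF A]
  have "vector_field A (X + Y)" if "vector_field A X" "vector_field A Y" for X Y
    using subspace_add[OF T vector_field_tangent[OF that(1)] vector_field_tangent[OF that(2)]]
      smooth_fun_add[OF A' smooth_fun_vector_field[OF that(1)] smooth_fun_vector_field[OF that(2)]]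
    by (simp add: vector_field_def plus_fun_def)
  moreover have "vector_field A (c *\<^sub>R X)" if "vector_field A X" for c X
    using subspace_scale[OF T vector_field_tangent[OF that]]
      smooth_fun_scaleR[OF A' smooth_fun_vector_field[OF that]]
    by (simp add: vector_field_def scaleR_fun_def)
  moreover have "vector_field A 0"
    using subspace_0[OF T] smooth_fun_zero[of A] by (simp add: vector_field_def zero_fun_def)
  ultimately show ?thesis by (simp add: subspace_def)
qed

lemma subspace_lie_algebra:
  assumes A: "smooth_atlas A"
  shows "subspace (lie_algebra G A)"
  using subspace_0[OF subspace_vector_fields[OF A]] subspace_add[OF subspace_vector_fields[OF A]]
    subspace_scale[OF subspace_vector_fields[OF A]]
  by (intro subspaceI) (auto simp: lie_algebra_def scaleR_fun_def fun_eq_iff)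

lemma derivation_of_apply: "derivation_of X Y f = Y (X f) - X (Y f)"
  by (simp add: derivation_of_def lie_bracket_def)

text \<open>Additivity of \<open>X\<close> is available on smooth functions; \<open>Y f\<close> and
  \<open>Z f\<close> are smooth because \<open>Y\<close> and \<open>Z\<close> are fields.\<close>

lemma derivation_of_add:
  assumes "charted A" "vector_field A X" "vector_field A Y" "vector_field A Z"
  shows "derivation_of X (Y + Z) = derivation_of X Y + derivation_of X Z"
proof
  fix f
  show "derivation_of X (Y + Z) f = (derivation_of X Y + derivation_of X Z) f"
    using vector_field_add[OF assms(1,2) smooth_fun_vector_field[OF assms(3), of f] smooth_fun_vector_field[OF assms(4), of f]]
    by (simp add: derivation_of_apply)
qed

lemma derivation_of_scaleR:
  assumes "charted A" "vector_field A X" "vector_field A Y"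
  shows "derivation_of X (c *\<^sub>R Y) = c *\<^sub>R derivation_of X Y"
proof
  fix f
  show "derivation_of X (c *\<^sub>R Y) f = (c *\<^sub>R derivation_of X Y) f"
    using vector_field_scaleR[OF assms(1,2) smooth_fun_vector_field[OF assms(3), of f], of c]
    by (simp add: derivation_of_apply scaleR_fun_def[of c Y] scaleR_fun_def[of c "derivation_of X Y"]
        scaleR_diff_right)
qed

section \<open>Right-invariant fields\<close>

context lie_group
begin

lemma charted: "charted A"
  using atlas by (rule charted_smooth_atlas)

lemma mult_assoc [simp]: "(x \<otimes> y) \<otimes> z = x \<otimes> (y \<otimes> z)"
  by (simp add: m_assoc carrier_eq)

lemma mult_one [simp]: "\<one> \<otimes> x = x" "x \<otimes> \<one> = x"
  by (simp_all add: carrier_eq)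

lemma smooth_map_mult:
  assumes "charted C" "smooth_map C A F" "smooth_map C A H"
  shows "smooth_map C A (\<lambda>z. F z \<otimes> H z)"
  using smooth_map_compose[OF assms(1) charted_prod_atlas[OF charted charted] charted
      smooth_map_Pair[OF assms(1) charted charted assms(2,3)] smooth_mult] by simp

lemma smooth_fun_right_translate: "smooth_fun A f \<Longrightarrow> smooth_fun A (\<lambda>x. f (x \<otimes> h))"
  by (rule smooth_fun_compose[OF charted charted
        smooth_map_mult[OF charted smooth_map_ident[OF atlas] smooth_map_const]])

lemma smooth_fun_left_translate: "smooth_fun A f \<Longrightarrow> smooth_fun A (\<lambda>x. f (h \<otimes> x))"
  by (rule smooth_fun_compose[OF charted charted
        smooth_map_mult[OF charted smooth_map_const smooth_map_ident[OF atlas]]])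

lemma lie_algebra_vector_field: "Y \<in> lie_algebra G A \<Longrightarrow> vector_field A Y"
  by (simp add: lie_algebra_def)

lemma lie_algebra_right_translate:
  "Y \<in> lie_algebra G A \<Longrightarrow> smooth_fun A f \<Longrightarrow> Y (\<lambda>x. f (x \<otimes> h)) = (\<lambda>x. Y f (x \<otimes> h))"
  by (simp add: lie_algebra_def)

lemma lie_algebra_at_one:
  assumes "Y \<in> lie_algebra G A" "smooth_fun A f"
  shows "Y f h = Y (\<lambda>x. f (x \<otimes> h)) \<one>"
  by (simp add: lie_algebra_right_translate[OF assms])

lemma lie_algebra_finite_dim: "\<exists>B. finite B \<and> lie_algebra G A \<subseteq> span B"
proof -
  obtain U \<psi> where U: "(U, \<psi>) \<in> A" "\<one> \<in> U" using charted_obtain_chart[OF charted] by blast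
  obtain B :: "'e set" where B: "finite B" "span B = UNIV" using charted_obtain_basis[OF charted] by blast
  \<comment> \<open>The right-invariant extension of the tangent vector \<open>v\<close>, with the
    default \<open>0\<close>. It suffices that \<open>range L\<close> contains the Lie algebra; that
    \<open>L v\<close> is itself a vector field is not claimed.\<close>
  define L where "L v = (\<lambda>f p. if smooth_fun A f then tangent_vector A U \<psi> \<one> v (\<lambda>x. f (x \<otimes> p)) else 0)" for v
  have "linear L"
    using linear_add[OF linear_tangent_vector[OF U]] linear_scale[OF linear_tangent_vector[OF U]]
    by (intro linearI) (auto simp: L_def fun_eq_iff scaleR_fun_def)
  have "lie_algebra G A \<subseteq> range L"
  proof
    fix Y assume Y: "Y \<in> lie_algebra G A"
    have "(\<lambda>f. Y f \<one>) \<in> range (tangent_vector A U \<psi> \<one>)"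
      unfolding tangent_space_eq_range[OF atlas U, symmetric]
      by (rule vector_field_tangent[OF lie_algebra_vector_field[OF Y]])
    then obtain v where v: "(\<lambda>f. Y f \<one>) = tangent_vector A U \<psi> \<one> v" by blast
    have "Y f p = L v f p" for f p
    proof (cases "smooth_fun A f")
      case True
      then show ?thesis using lie_algebra_at_one[OF Y True, of p] fun_cong[OF v, of "\<lambda>x. f (x \<otimes> p)"]
        by (simp add: L_def)
    next
      case False
      then show ?thesis using vector_field_not_smooth[OF lie_algebra_vector_field[OF Y] False]
        by (simp add: L_def)
    qed
    then have "Y = L v" by (intro ext)
    then show "Y \<in> range L" by blast
  qed
  also have "range L = span (L ` B)" using B(2) linear_span_image[OF \<open>linear L\<close>, of B] by simp
  finally show ?thesis using B(1) by blast
qed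

section \<open>Flows of linear vector fields and invariance of the Lie algebra\<close>

context
  fixes X :: "'g operator" and \<Phi> :: "real \<Rightarrow> 'g \<Rightarrow> 'g"
  assumes X: "vector_field A X" and flow: "flow_of A X \<Phi>" and aut: "\<And>t. \<Phi> t \<in> lie_automorphisms G A"
begin

lemma flow_mult: "\<Phi> t (x \<otimes> y) = \<Phi> t x \<otimes> \<Phi> t y"
  using aut[of t] hom_mult[of "\<Phi> t" G G x y] by (simp add: lie_automorphisms_def iso_def carrier_eq)

lemma flow_one: "\<Phi> t \<one> = \<one>"
proof -
  have "\<Phi> t \<in> hom G G" using aut[of t] by (simp add: lie_automorphisms_def iso_def)
  then show ?thesis by (rule hom_one) (rule is_group)+
qed

lemma flow_0: "\<Phi> 0 x = x"
  using flow by (simp add: flow_of_def)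

lemma flow_derivative: "smooth_fun A f \<Longrightarrow> ((\<lambda>s. f (\<Phi> s x)) has_real_derivative X f x) (at 0)"
  using flow unfolding flow_of_def by (metis id_apply)

lemma linear_field_at_one: "smooth_fun A f \<Longrightarrow> X f \<one> = 0"
  using flow_derivative[of f \<one>] DERIV_unique[OF _ DERIV_const] by (simp add: flow_one)

lemma smooth_map_flow:
  assumes "charted C" "smooth_map C real_atlas \<tau>" "smooth_map C A F"
  shows "smooth_map C A (\<lambda>z. \<Phi> (\<tau> z) (F z))"
proof -
  have "smooth_map (prod_atlas real_atlas A) A (\<lambda>(t, x). \<Phi> t x)" using flow by (simp add: flow_of_def)
  from smooth_map_compose[OF assms(1) charted_prod_atlas[OF charted_real_atlas charted] charted
      smooth_map_Pair[OF assms(1) charted_real_atlas charted assms(2,3)] this]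
  show ?thesis by simp
qed

text \<open>Leibniz rule along \<open>\<Phi> t (g \<otimes> h) = \<Phi> t g \<otimes> \<Phi> t h\<close>; it measures the failure of \<open>X\<close> to be
  right invariant.\<close>

lemma linear_field_mult:
  assumes f: "smooth_fun A f"
  shows "X f (g \<otimes> h) = X (\<lambda>x. f (x \<otimes> h)) g + X (\<lambda>x. f (g \<otimes> x)) h"
proof -
  note RR = charted_prod_atlas[OF charted_real_atlas charted_real_atlas]
  \<comment> \<open>Two independent times: the left side of the Leibniz rule is the derivative of
    \<open>J\<close> along the diagonal, its two summands are the derivatives along the
    axes.\<close>
  define J where "J = (\<lambda>z. f (\<Phi> (fst z) g \<otimes> \<Phi> (snd z) h))"
  have "smooth_map (prod_atlas real_atlas real_atlas) A (\<lambda>z. \<Phi> (fst z) g \<otimes> \<Phi> (snd z) h)"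
    by (intro smooth_map_mult[OF RR] smooth_map_flow[OF RR] smooth_map_const
        smooth_map_fst smooth_map_snd charted_real_atlas smooth_map_real_ident)
  from smooth_fun_compose[OF RR charted this f]
  have "smooth_fun (prod_atlas real_atlas real_atlas) J" by (simp add: J_def)
  from smooth_fun_prod_real[OF charted_real_atlas this, of UNIV id 1]
  have "Ck_on (Suc 0) UNIV J" by (simp add: real_atlas_def case_prod_beta')
  then have diff: "J differentiable (at z)" for z by (simp only: Ck_on.simps UNIV_I)
  let ?J' = "frechet_derivative J (at (0, 0))"
  have line: "((\<lambda>s. J ((0, 0) + s *\<^sub>R v)) has_real_derivative ?J' v) (at 0)" for v
    using has_real_derivative_along_line[OF diff, of "(0, 0)" v 0] by simp
  have "X f (g \<otimes> h) = ?J' (1, 1)"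
    using flow_derivative[OF f, of "g \<otimes> h"] line[of "(1, 1)"]
    by (simp add: J_def flow_mult DERIV_unique)
  moreover have "X (\<lambda>x. f (x \<otimes> h)) g = ?J' (1, 0)"
    using flow_derivative[OF smooth_fun_right_translate[OF f, of h], of g] line[of "(1, 0)"]
    by (simp add: J_def flow_0 DERIV_unique)
  moreover have "X (\<lambda>x. f (g \<otimes> x)) h = ?J' (0, 1)"
    using flow_derivative[OF smooth_fun_left_translate[OF f, of g], of h] line[of "(0, 1)"]
    by (simp add: J_def flow_0 DERIV_unique)
  moreover have "?J' (1, 1) = ?J' (1, 0) + ?J' (0, 1)"
    using linear_add[OF linear_frechet_derivative[OF diff], of "(0, 0)" "(1, 0)" "(0, 1)"] by simp
  ultimately show ?thesis by simp
qed

text \<open>Both sides are mixed derivatives of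
  \<open>f (y \<otimes> (g \<otimes> \<Phi> t h))\<close> at \<open>y = \<one>\<close>,
  \<open>t = 0\<close>: by right invariance \<open>Y\<close> differentiates in the left factor
  \<open>y\<close>, while \<open>X\<close> differentiates in time.\<close>

lemma lie_algebra_linear_field_commute:
  assumes Y: "Y \<in> lie_algebra G A" and f: "smooth_fun A f"
  shows "Y (\<lambda>a. X (\<lambda>x. f (a \<otimes> x)) h) g = X (\<lambda>x. Y f (g \<otimes> x)) h"
proof -
  note AR = charted_prod_atlas[OF charted charted_real_atlas]
  note vfY = lie_algebra_vector_field[OF Y]
  let ?u = "\<lambda>a. X (\<lambda>x. f (a \<otimes> x)) h"
  \<comment> \<open>Smoothness in the parameter \<open>a\<close> is not visible from
    \<open>?u\<close>; the Leibniz rule rewrites it as a difference of functions that are visibly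
    smooth.\<close>
  have u: "?u = (\<lambda>a. X f (a \<otimes> h)) - X (\<lambda>x. f (x \<otimes> h))"
    by (auto simp: linear_field_mult[OF f])
  have smooth_u: "smooth_fun A ?u"
    unfolding u by (intro smooth_fun_diff[OF charted] smooth_fun_right_translate smooth_fun_vector_field[OF X])
  obtain U \<psi> where U: "(U, \<psi>) \<in> A" "\<one> \<in> U" using charted_obtain_chart[OF charted] by blast
  have "(\<lambda>f. Y f \<one>) \<in> range (tangent_vector A U \<psi> \<one>)"
    unfolding tangent_space_eq_range[OF atlas U, symmetric] by (rule vector_field_tangent[OF vfY])
  then obtain v where v: "(\<lambda>f. Y f \<one>) = tangent_vector A U \<psi> \<one> v" by blast
  \<comment> \<open>Right invariance reduces \<open>Y\<close> at every point \<open>p\<close> to one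
    fixed direction \<open>v\<close> at the identity.\<close>
  have Y_eq: "Y k p = frechet_derivative (\<lambda>y. k (inv_into U \<psi> y \<otimes> p)) (at (\<psi> \<one>)) v" if "smooth_fun A k" for k p
    using lie_algebra_at_one[OF Y that, of p] fun_cong[OF v, of "\<lambda>x. k (x \<otimes> p)"]
      smooth_fun_right_translate[OF that, of p]
    by (simp add: tangent_vector_def o_def)
  have "smooth_map (prod_atlas A real_atlas) A (\<lambda>z. fst z \<otimes> (g \<otimes> \<Phi> (snd z) h))"
    by (intro smooth_map_mult[OF AR] smooth_map_flow[OF AR] smooth_map_const
        smooth_map_fst smooth_map_snd charted charted_real_atlas smooth_map_real_ident smooth_map_ident atlas)
  from smooth_fun_prod_real[OF charted smooth_fun_compose[OF AR charted this f] U(1), of 2]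
  have K: "Ck_on 2 (\<psi> ` U \<times> UNIV) (\<lambda>(y, t). f (inv_into U \<psi> y \<otimes> (g \<otimes> \<Phi> t h)))" by simp
  have "((\<lambda>t. f (inv_into U \<psi> y \<otimes> (g \<otimes> \<Phi> t h))) has_real_derivative ?u (inv_into U \<psi> y \<otimes> g)) (at 0)" for y
    using flow_derivative[OF smooth_fun_left_translate[OF f, of "inv_into U \<psi> y \<otimes> g"], of h] by simp
  then have "((\<lambda>t. frechet_derivative (\<lambda>y. f (inv_into U \<psi> y \<otimes> (g \<otimes> \<Phi> t h))) (at (\<psi> \<one>)) v)
      has_real_derivative frechet_derivative (\<lambda>y. ?u (inv_into U \<psi> y \<otimes> g)) (at (\<psi> \<one>)) v) (at 0)"
    using partial_derivatives_commute[OF K chart_open(2)[OF charted U(1)], of "\<psi> \<one>"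
        "\<lambda>y. ?u (inv_into U \<psi> y \<otimes> g)" v] U(2) by simp
  then have "((\<lambda>t. Y f (g \<otimes> \<Phi> t h)) has_real_derivative Y ?u g) (at 0)"
    by (simp add: Y_eq[OF f] Y_eq[OF smooth_u])
  from DERIV_unique[OF this flow_derivative[OF smooth_fun_left_translate[OF smooth_fun_vector_field[OF vfY]]]]
  show ?thesis .
qed

text \<open>\<open>X\<close> fails to be right invariant, and so do \<open>Y (X f)\<close> and
  \<open>X (Y f)\<close>, but both by the same term
  \<open>X (\<lambda>x. Y f (g \<otimes> x)) h\<close>, which cancels in the commutator.\<close>

lemma derivation_right_translate:
  assumes Y: "Y \<in> lie_algebra G A" and f: "smooth_fun A f"
  shows "derivation_of X Y (\<lambda>x. f (x \<otimes> h)) = (\<lambda>x. derivation_of X Y f (x \<otimes> h))"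
proof
  fix g
  note vfY = lie_algebra_vector_field[OF Y]
  note Xf = smooth_fun_vector_field[OF X, of f] and Yf = smooth_fun_vector_field[OF vfY, of f]
  have u: "(\<lambda>a. X (\<lambda>x. f (a \<otimes> x)) h) = (\<lambda>a. X f (a \<otimes> h)) - X (\<lambda>x. f (x \<otimes> h))"
    by (auto simp: linear_field_mult[OF f])
  have "Y (\<lambda>a. X (\<lambda>x. f (a \<otimes> x)) h) g = Y (\<lambda>a. X f (a \<otimes> h)) g - Y (X (\<lambda>x. f (x \<otimes> h))) g"
    unfolding u using vector_field_diff[OF charted vfY smooth_fun_right_translate[OF Xf] smooth_fun_vector_field[OF X]]
    by simp
  then have "Y (X (\<lambda>x. f (x \<otimes> h))) g = Y (X f) (g \<otimes> h) - X (\<lambda>x. Y f (g \<otimes> x)) h"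
    by (simp add: lie_algebra_linear_field_commute[OF Y f] lie_algebra_right_translate[OF Y Xf])
  moreover have "X (Y (\<lambda>x. f (x \<otimes> h))) g = X (Y f) (g \<otimes> h) - X (\<lambda>x. Y f (g \<otimes> x)) h"
    by (simp add: lie_algebra_right_translate[OF Y f] linear_field_mult[OF Yf])
  ultimately show "derivation_of X Y (\<lambda>x. f (x \<otimes> h)) g = derivation_of X Y f (g \<otimes> h)"
    by (simp add: derivation_of_apply)
qed

text \<open>Since \<open>X\<close> vanishes at \<open>\<one>\<close>, the derivation acts there as the derivative of the linearised flow.\<close>

lemma derivation_tangent_at_one:
  assumes Y: "Y \<in> lie_algebra G A" and U: "(U, \<psi>) \<in> A" "\<one> \<in> U"
  shows "\<exists>w. \<forall>f. smooth_fun A f \<longrightarrow>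
    derivation_of X Y f \<one> = frechet_derivative (f \<circ> inv_into U \<psi>) (at (\<psi> \<one>)) w"
proof -
  note AR = charted_prod_atlas[OF charted charted_real_atlas]
  note vfY = lie_algebra_vector_field[OF Y]
  have "(\<lambda>f. Y f \<one>) \<in> range (tangent_vector A U \<psi> \<one>)"
    unfolding tangent_space_eq_range[OF atlas U, symmetric] by (rule vector_field_tangent[OF vfY])
  then obtain v where v: "(\<lambda>f. Y f \<one>) = tangent_vector A U \<psi> \<one> v" by blast
  have flow_smooth: "smooth_map (prod_atlas A real_atlas) A (\<lambda>z. \<Phi> (snd z) (fst z))"
    by (intro smooth_map_flow[OF AR] smooth_map_fst smooth_map_snd charted charted_real_atlas
        smooth_map_real_ident smooth_map_ident atlas)
  \<comment> \<open>\<open>N\<close> is the flow in coordinates, jointly in point and time;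
    \<open>\<eta> t\<close> is the image of the direction \<open>v\<close> under the linearised flow
    at the identity. Its velocity at time \<open>0\<close> is the witness sought.\<close>
  define N where "N = (\<lambda>z. \<psi> (\<Phi> (snd z) (inv_into U \<psi> (fst z))))"
  define \<eta> where "\<eta> t = frechet_derivative N (at (\<psi> \<one>, t)) (v, 0)" for t
  have R: "(UNIV, id) \<in> real_atlas" by (simp add: real_atlas_def)
  \<comment> \<open>The flow may leave the chart, so \<open>N\<close> is controlled only on
    \<open>T\<close>; the identity lies in \<open>T\<close> at all times because the flow fixes
    it.\<close>
  define T where "T = map_prod \<psi> id ` ((U \<times> UNIV) \<inter> (\<lambda>z. \<Phi> (snd z) (fst z)) -` U)"
  have T: "open T"
    unfolding T_def
    by (intro chart_open_image[OF AR prod_atlasI[OF U(1) R]] smooth_map_open_vimage[OF flow_smooth]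
        chart_open(1)[OF charted U(1)])
  have inT: "(\<psi> \<one>, t) \<in> T" for t
  proof -
    have "(\<psi> \<one>, t) = map_prod \<psi> id (\<one>, t)" by simp
    then show ?thesis unfolding T_def using U(2) by (auto simp: flow_one simp del: map_prod_simp)
  qed
  have "Ck_on 2 T (\<lambda>z. \<psi> (\<Phi> (snd (inv_into (U \<times> UNIV) (map_prod \<psi> id) z))
      (fst (inv_into (U \<times> UNIV) (map_prod \<psi> id) z))))"
    unfolding T_def by (rule smooth_map_Ck[OF flow_smooth prod_atlasI[OF U(1) R] U(1)])
  then have N: "Ck_on 2 T N"
  proof (rule Ck_on_cong[OF T, rotated])
    fix z assume "z \<in> T"
    then obtain x t where "x \<in> U" "z = (\<psi> x, id t)" by (auto simp: T_def)
    then show "\<psi> (\<Phi> (snd (inv_into (U \<times> UNIV) (map_prod \<psi> id) z))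
        (fst (inv_into (U \<times> UNIV) (map_prod \<psi> id) z))) = N z"
      using inv_into_map_prod[OF chart_inj_on[OF charted U(1)], of id UNIV x t]
        chart_inv_into[OF charted U(1)] by (simp add: N_def)
  qed
  have N': "(N has_derivative frechet_derivative N (at (\<psi> \<one>, t))) (at (\<psi> \<one>, t))" for t
    using N inT by (simp add: numeral_2_eq_2 frechet_derivative_works)
  have "(\<lambda>z. frechet_derivative N (at z) (v, 0)) differentiable (at (\<psi> \<one>, 0))"
    using N inT by (simp add: numeral_2_eq_2)
  then have "((\<lambda>z. frechet_derivative N (at z) (v, 0)) has_derivative
      frechet_derivative (\<lambda>z. frechet_derivative N (at z) (v, 0)) (at (\<psi> \<one>, 0))) (at (\<psi> \<one>, 0))"
    by (simp add: frechet_derivative_works)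
  moreover have "((\<lambda>t. (\<psi> \<one>, t)) has_derivative (\<lambda>t. (0, t))) (at 0)"
    by (intro has_derivative_Pair has_derivative_ident has_derivative_const)
  ultimately obtain \<eta>' where \<eta>: "(\<eta> has_derivative \<eta>') (at 0)"
    unfolding \<eta>_def using has_derivative_compose[where f = "\<lambda>t. (\<psi> \<one>, t)" and x = "0::real"
        and g = "\<lambda>z. frechet_derivative N (at z) (v, 0)"] by blast
  have "derivation_of X Y f \<one> = frechet_derivative (f \<circ> inv_into U \<psi>) (at (\<psi> \<one>)) (\<eta>' 1)"
    if f: "smooth_fun A f" for f
  proof -
    let ?f = "f \<circ> inv_into U \<psi>"
    have linear_part: "frechet_derivative (\<lambda>y. f (\<Phi> t (inv_into U \<psi> y))) (at (\<psi> \<one>)) v =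
        frechet_derivative ?f (at (\<psi> \<one>)) (\<eta> t)" for t
    proof -
      have "smooth_map A A (\<Phi> t)" using aut[of t] by (simp add: lie_automorphisms_def)
      moreover have "\<Phi> t \<one> \<in> U" using U(2) by (simp add: flow_one)
      ultimately have "frechet_derivative ((\<lambda>x. f (\<Phi> t x)) \<circ> inv_into U \<psi>) (at (\<psi> \<one>)) v =
          frechet_derivative ?f (at (\<psi> (\<Phi> t \<one>)))
            (frechet_derivative (\<lambda>x. \<psi> (\<Phi> t (inv_into U \<psi> x))) (at (\<psi> \<one>)) v)"
        using frechet_derivative_push_forward[OF charted charted _ U U(1) _ f] by blast
      moreover have "frechet_derivative (\<lambda>x. \<psi> (\<Phi> t (inv_into U \<psi> x))) (at (\<psi> \<one>)) v = \<eta> t"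
      proof -
        have "((\<lambda>y. (y, t)) has_derivative (\<lambda>v. (v, 0))) (at (\<psi> \<one>))"
          by (intro has_derivative_Pair has_derivative_ident has_derivative_const)
        from has_derivative_compose[where f = "\<lambda>y. (y, t)" and g = N, OF this N']
        have "((\<lambda>y. \<psi> (\<Phi> t (inv_into U \<psi> y))) has_derivative
            (\<lambda>v. frechet_derivative N (at (\<psi> \<one>, t)) (v, 0))) (at (\<psi> \<one>))"
          by (simp add: N_def)
        from frechet_derivative_at[OF this] show ?thesis unfolding \<eta>_def by metis
      qed
      ultimately show ?thesis by (simp add: flow_one o_def)
    qed
    have K: "Ck_on 2 (\<psi> ` U \<times> UNIV) (\<lambda>(y, t). f (\<Phi> t (inv_into U \<psi> y)))"
      using smooth_fun_prod_real[OF charted smooth_fun_compose[OF AR charted flow_smooth f] U(1), of 2] by simp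
    \<comment> \<open>One time derivative is computed twice: exchanged with the direction
      \<open>v\<close> it gives \<open>Y (X f)\<close> at the identity, and by linearity in
      \<open>\<eta>\<close> it gives the derivative of \<open>f\<close> in direction
      \<open>\<eta>' 1\<close>.\<close>
    have "((\<lambda>t. frechet_derivative ?f (at (\<psi> \<one>)) (\<eta> t)) has_real_derivative
        frechet_derivative (\<lambda>y. X f (inv_into U \<psi> y)) (at (\<psi> \<one>)) v) (at 0)"
      using partial_derivatives_commute[OF K chart_open(2)[OF charted U(1)], of "\<psi> \<one>"
          "\<lambda>y. X f (inv_into U \<psi> y)" v] U(2) flow_derivative[OF f]
      by (simp add: linear_part)
    moreover have "((\<lambda>t. frechet_derivative ?f (at (\<psi> \<one>)) (\<eta> t)) has_real_derivative
        frechet_derivative ?f (at (\<psi> \<one>)) (\<eta>' 1)) (at 0)"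
    proof -
      have bl: "bounded_linear (frechet_derivative ?f (at (\<psi> \<one>)))"
        using smooth_fun_has_derivative[OF f U] by (rule has_derivative_bounded_linear)
      have "\<eta>' h = h *\<^sub>R \<eta>' 1" for h
        using linear_scale[OF has_derivative_linear[OF \<eta>], of h 1] by simp
      then have "frechet_derivative ?f (at (\<psi> \<one>)) (\<eta>' h) = frechet_derivative ?f (at (\<psi> \<one>)) (\<eta>' 1) * h" for h
        using linear_scale[OF bounded_linear.linear[OF bl], of h "\<eta>' 1"] by (metis mult.commute real_scaleR_def)
      then have "(\<lambda>h. frechet_derivative ?f (at (\<psi> \<one>)) (\<eta>' h)) = (*) (frechet_derivative ?f (at (\<psi> \<one>)) (\<eta>' 1))"
        by (intro ext)
      then show ?thesis
        using bounded_linear.has_derivative[OF bl \<eta>] unfolding has_field_derivative_def by metis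
    qed
    ultimately have "frechet_derivative (\<lambda>y. X f (inv_into U \<psi> y)) (at (\<psi> \<one>)) v =
        frechet_derivative ?f (at (\<psi> \<one>)) (\<eta>' 1)" by (rule DERIV_unique)
    moreover have "Y (X f) \<one> = frechet_derivative (\<lambda>y. X f (inv_into U \<psi> y)) (at (\<psi> \<one>)) v"
      using fun_cong[OF v, of "X f"] smooth_fun_vector_field[OF X, of f]
      by (simp add: tangent_vector_def o_def)
    ultimately show ?thesis
      by (simp add: derivation_of_apply linear_field_at_one[OF smooth_fun_vector_field[OF vfY]])
  qed
  then show ?thesis by blast
qed

text \<open>Tangency at \<open>p\<close> needs an explicit direction there: the one at the identity
  is pushed forward by right translation by \<open>p\<close>, legitimate because the derivation of
  \<open>Y\<close> is already known to be right invariant.\<close>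

lemma derivation_lie_algebra:
  assumes Y: "Y \<in> lie_algebra G A"
  shows "derivation_of X Y \<in> lie_algebra G A"
proof -
  note vfY = lie_algebra_vector_field[OF Y]
  obtain U \<psi> where U: "(U, \<psi>) \<in> A" "\<one> \<in> U" using charted_obtain_chart[OF charted] by blast
  obtain w where w: "\<And>f. smooth_fun A f \<Longrightarrow>
      derivation_of X Y f \<one> = frechet_derivative (f \<circ> inv_into U \<psi>) (at (\<psi> \<one>)) w"
    using derivation_tangent_at_one[OF Y U] by blast
  have "(\<lambda>f. derivation_of X Y f p) \<in> tangent_space A p" for p
  proof -
    obtain V \<phi> where V: "(V, \<phi>) \<in> A" "p \<in> V" using charted_obtain_chart[OF charted] by blast
    have translate: "smooth_map A A (\<lambda>x. x \<otimes> p)"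
      by (intro smooth_map_mult charted smooth_map_ident[OF atlas] smooth_map_const)
    let ?w = "frechet_derivative (\<lambda>x. \<phi> (inv_into U \<psi> x \<otimes> p)) (at (\<psi> \<one>)) w"
    have "derivation_of X Y f p = tangent_vector A V \<phi> p ?w f" for f
    proof (cases "smooth_fun A f")
      case True
      have "derivation_of X Y f p = derivation_of X Y (\<lambda>x. f (x \<otimes> p)) \<one>"
        by (simp add: derivation_right_translate[OF Y True])
      also have "\<dots> = frechet_derivative ((\<lambda>x. f (x \<otimes> p)) \<circ> inv_into U \<psi>) (at (\<psi> \<one>)) w"
        by (rule w[OF smooth_fun_right_translate[OF True]])
      also have "\<dots> = frechet_derivative (f \<circ> inv_into V \<phi>) (at (\<phi> p)) ?w"
        using frechet_derivative_push_forward[OF charted charted translate U V(1) _ True] V(2) by simp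
      finally show ?thesis using True by (simp add: tangent_vector_def)
    next
      \<comment> \<open>Here both sides are the default \<open>0\<close>: \<open>X f\<close> and
        \<open>Y f\<close> vanish, and fields map \<open>0\<close> to \<open>0\<close>.\<close>
      case False
      then show ?thesis
        by (simp add: derivation_of_apply vector_field_not_smooth[OF X] vector_field_not_smooth[OF vfY]
            vector_field_zero[OF charted X] vector_field_zero[OF charted vfY] tangent_vector_def)
    qed
    then show ?thesis unfolding tangent_space_eq_range[OF atlas V] by auto
  qed
  moreover have "smooth_fun A (derivation_of X Y f)" for f
    unfolding derivation_of_apply
    by (intro smooth_fun_diff[OF charted] smooth_fun_vector_field[OF X] smooth_fun_vector_field[OF vfY])
  ultimately show ?thesis
    using derivation_right_translate[OF Y] by (simp add: lie_algebra_def vector_field_def)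
qed

end

end

section \<open>Primary decomposition on the complexification\<close>

lemma cscale_0_left [simp]: "cscale 0 z = 0"
  by (cases z) (simp add: cscale_def zero_prod_def)

lemma cscale_0_right [simp]: "cscale a 0 = 0"
  by (simp add: cscale_def zero_prod_def)

lemma cscale_1 [simp]: "cscale 1 z = z"
  by (cases z) (simp add: cscale_def)

lemma cscale_add_right: "cscale a (y + z) = cscale a y + cscale a z"
  by (cases y; cases z) (simp add: cscale_def algebra_simps)

lemma cscale_add_left: "cscale (a + b) z = cscale a z + cscale b z"
  by (cases z) (simp add: cscale_def algebra_simps)

lemma cscale_minus_left: "cscale (- a) z = - cscale a z"
  by (cases z) (simp add: cscale_def)

lemma cscale_mult: "cscale (a * b) z = cscale a (cscale b z)"
  by (cases z) (simp add: cscale_def algebra_simps)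

lemma map_prod_cscale:
  assumes "linear D"
  shows "map_prod D D (cscale a z) = cscale a (map_prod D D z)"
  using linear_diff[OF assms] linear_add[OF assms] linear_scale[OF assms]
  by (cases z) (simp add: cscale_def)

lemma linear_map_prod:
  assumes "linear D"
  shows "linear (map_prod D D)"
  using linear_add[OF assms] linear_scale[OF assms]
  by (intro linearI) (auto simp: map_prod_def split: prod.splits)

lemma linear_cscale: "linear (cscale a)"
  by (intro linearI) (auto simp: cscale_def algebra_simps)

text \<open>Horner evaluation of a complex polynomial at the complexified map. Pairs carry only a
  real vector space structure, so complex scalars act through \<open>cscale\<close>.\<close>

definition poly_act :: "('v::real_vector \<Rightarrow> 'v) \<Rightarrow> complex poly \<Rightarrow> 'v \<times> 'v \<Rightarrow> 'v \<times> 'v" where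
  "poly_act D p = fold_coeffs (\<lambda>a r z. cscale a z + map_prod D D (r z)) p (\<lambda>z. 0)"

lemma poly_act_0 [simp]: "poly_act D 0 z = 0"
  by (simp add: poly_act_def)

context
  fixes D :: "'v::real_vector \<Rightarrow> 'v"
  assumes D: "linear D"
begin

lemma poly_act_pCons [simp]:
  "poly_act D (pCons a p) z = cscale a z + map_prod D D (poly_act D p z)"
  using linear_0[OF linear_map_prod[OF D]]
  \<comment> \<open>The recursion of \<open>fold_coeffs\<close> excludes the degenerate
    \<open>pCons 0 0\<close>, where both sides vanish.\<close>
  by (cases "a = 0 \<and> p = 0") (auto simp: poly_act_def)

lemma linear_poly_act: "linear (poly_act D p)"
proof (induction p)
  case 0
  then show ?case by (simp add: module_hom_zero poly_act_def id_def)
next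
  case (pCons a p)
  then show ?case
    using linear_compose_add[OF linear_cscale linear_compose[OF pCons.IH linear_map_prod[OF D]]]
    by (simp add: o_def poly_act_pCons[abs_def])
qed

lemma poly_act_add: "poly_act D (p + q) z = poly_act D p z + poly_act D q z"
  by (induction p q rule: poly_induct2)
    (simp_all add: cscale_add_left linear_add[OF linear_map_prod[OF D]])

lemma poly_act_smult: "poly_act D (smult a p) z = cscale a (poly_act D p z)"
  by (induction p) (simp_all add: cscale_add_right cscale_mult map_prod_cscale[OF D])

lemma poly_act_mult: "poly_act D (p * q) z = poly_act D p (poly_act D q z)"
  by (induction p) (simp_all add: mult_pCons_left poly_act_add poly_act_smult)

text \<open>Polynomials in one map commute, so it does not matter which factor kills
  \<open>z\<close>.\<close>

lemma poly_act_mult_eq_0: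
  assumes "poly_act D p z = 0 \<or> poly_act D q z = 0"
  shows "poly_act D (p * q) z = 0"
proof -
  have "poly_act D p (poly_act D q z) = poly_act D q (poly_act D p z)"
    by (simp only: poly_act_mult[symmetric] mult.commute)
  then show ?thesis using assms linear_0[OF linear_poly_act] by (auto simp: poly_act_mult)
qed

lemma poly_act_1 [simp]: "poly_act D 1 z = z"
  using linear_0[OF linear_map_prod[OF D]] by (simp add: one_pCons)

lemma poly_act_linear_factor:
  "poly_act D [:- l, 1:] = (\<lambda>y. map_prod D D y - cscale l y)"
  using linear_0[OF linear_map_prod[OF D]] by (auto simp: cscale_minus_left)

lemma poly_act_power_linear_factor:
  "poly_act D ([:- l, 1:] ^ n) z = ((\<lambda>y. map_prod D D y - cscale l y) ^^ n) z"
proof (induction n)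
  case (Suc n)
  then show ?case
    by (simp only: power_Suc poly_act_mult funpow.simps o_apply poly_act_linear_factor)
qed simp

lemma poly_act_in:
  assumes V: "subspace V" and inv: "D ` V \<subseteq> V" and z: "z \<in> V \<times> V"
  shows "poly_act D p z \<in> V \<times> V"
proof (induction p)
  case 0
  then show ?case using subspace_0[OF V] by (simp add: zero_prod_def)
next
  case (pCons a p)
  have "cscale a z \<in> V \<times> V"
    using z V by (cases z) (auto simp: cscale_def intro!: subspace_add subspace_diff subspace_scale)
  with pCons show ?case
    using inv subspace_add[OF V]
    by (cases "poly_act D p z"; cases "cscale a z") auto
qed

section \<open>Generalized eigenspaces and Bezout's identity\<close>

lemma mem_generalized_eigenspace_iff:
  "z \<in> generalized_eigenspace V D l \<longleftrightarrow> z \<in> V \<times> V \<and> (\<exists>n. poly_act D ([:- l, 1:] ^ n) z = 0)"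
  by (simp add: generalized_eigenspace_def poly_act_power_linear_factor)

text \<open>The last nonzero vector among the iterates of \<open>D - l\<close> is an eigenvector,
  and the iterates stay in \<open>V \<times> V\<close>.\<close>

lemma eigenvalue_of_generalized_eigenvector:
  assumes V: "subspace V" and inv: "D ` V \<subseteq> V"
    and z: "z \<in> generalized_eigenspace V D l" "z \<noteq> 0"
  shows "eigenvalue_on V D l"
proof -
  from z obtain n where n: "z \<in> V \<times> V" "poly_act D ([:- l, 1:] ^ n) z = 0"
    by (auto simp: mem_generalized_eigenspace_iff)
  have *: "eigenvalue_on V D l" if "z \<in> V \<times> V" "z \<noteq> 0" "poly_act D ([:- l, 1:] ^ n) z = 0" for z n
    using that
  proof (induction n arbitrary: z)
    case (Suc n)
    let ?y = "poly_act D [:- l, 1:] z"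
    have "poly_act D ([:- l, 1:] ^ n) ?y = 0"
      using Suc.prems(3) by (simp only: power_Suc2 poly_act_mult)
    show ?case
    proof (cases "?y = 0")
      case True
      then have "map_prod D D z = cscale l z"
        using fun_cong[OF poly_act_linear_factor[of l], of z] by simp
      then show ?thesis using Suc.prems(1,2) unfolding eigenvalue_on_def by blast
    next
      case False
      then show ?thesis
        using Suc.IH[of ?y] \<open>poly_act D ([:- l, 1:] ^ n) ?y = 0\<close> poly_act_in[OF V inv Suc.prems(1)]
        by blast
    qed
  qed simp
  show ?thesis by (rule *[OF n(1) z(2) n(2)])
qed

lemma poly_act_coprime_split:
  assumes "coprime p q" and "poly_act D (p * q) z = 0"
  obtains a b where "z = poly_act D a z + poly_act D b z"
    "poly_act D p (poly_act D a z) = 0" "poly_act D q (poly_act D b z) = 0"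
proof -
  obtain s t where st: "s * p + t * q = 1"
    using bezout_coefficients_fst_snd[of p q] assms(1) by (metis coprime_imp_gcd_eq_1)
  show thesis
  \<comment> \<open>The factors cross over: \<open>t * q\<close> yields the part killed by
    \<open>p\<close>, since \<open>p * t * q\<close> is a multiple of \<open>p * q\<close>.\<close>
  proof (rule that[of "t * q" "s * p"])
    have "z = poly_act D (s * p + t * q) z" by (simp add: st)
    then show "z = poly_act D (t * q) z + poly_act D (s * p) z"
      by (simp only: poly_act_add add.commute)
    have "poly_act D p (poly_act D (t * q) z) = poly_act D t (poly_act D (p * q) z)"
      by (simp only: poly_act_mult[symmetric] ac_simps)
    then show "poly_act D p (poly_act D (t * q) z) = 0"
      using assms(2) linear_0[OF linear_poly_act] by simp
    have "poly_act D q (poly_act D (s * p) z) = poly_act D s (poly_act D (p * q) z)"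
      by (simp only: poly_act_mult[symmetric] ac_simps)
    then show "poly_act D q (poly_act D (s * p) z) = 0"
      using assms(2) linear_0[OF linear_poly_act] by simp
  qed
qed

text \<open>A nonconstant common divisor would have a complex root, common to \<open>p\<close> and
  \<open>q\<close>.\<close>

lemma coprime_poly_complexI:
  fixes p q :: "complex poly"
  assumes "p \<noteq> 0" and "\<And>x. poly p x = 0 \<Longrightarrow> poly q x \<noteq> 0"
  shows "coprime p q"
proof (rule coprimeI)
  fix c assume c: "c dvd p" "c dvd q"
  have "c \<noteq> 0" using c(1) assms(1) by auto
  have "constant (poly c)"
  proof (rule ccontr)
    assume "\<not> constant (poly c)"
    then obtain x where "poly c x = 0" using fundamental_theorem_of_algebra by blast
    then have "poly p x = 0" "poly q x = 0" using c by (auto elim!: dvdE)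
    then show False using assms(2) by blast
  qed
  then show "is_unit c"
    using \<open>c \<noteq> 0\<close> by (simp add: constant_degree is_unit_iff_degree)
qed

text \<open>\<open>p\<close> is any annihilator of the one vector \<open>z\<close>. Splitting off
  the full power of one root leaves a coprime cofactor of smaller degree, which annihilates the
  remaining part.\<close>

lemma primary_decomposition:
  assumes V: "subspace V" and inv: "D ` V \<subseteq> V"
    and "z \<in> V \<times> V" "p \<noteq> 0" "poly_act D p z = 0"
  shows "z \<in> span (\<Union>l\<in>{l. eigenvalue_on V D l}. generalized_eigenspace V D l)"
  using assms(3-)
proof (induction "degree p" arbitrary: p z rule: less_induct)
  case less
  show ?case
  proof (cases "degree p = 0")
    case True
    then obtain c where "p = [:c:]" by (metis degree_eq_zeroE)
    then have "cscale c z = 0" "c \<noteq> 0"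
      using less.prems linear_0[OF linear_map_prod[OF D]] by auto
    then have "cscale (inverse c * c) z = 0" by (simp only: cscale_mult cscale_0_right)
    then have "z = 0" using \<open>c \<noteq> 0\<close> by simp
    then show ?thesis by (simp add: span_zero)
  next
    case False
    then obtain l where l: "poly p l = 0"
      using fundamental_theorem_of_algebra[of p] by (auto simp: constant_degree)
    define r where "r = [:- l, 1:] ^ Polynomial.order l p"
    obtain q where q: "p = r * q" "\<not> [:- l, 1:] dvd q"
      using order_decomp[OF less.prems(2), of l] unfolding r_def by blast
    have "Polynomial.order l p > 0" using l less.prems(2) order_root by blast
    have "q \<noteq> 0" "r \<noteq> 0" using q less.prems(2) by auto
    then have "degree p = degree r + degree q"
      by (subst q(1)) (rule degree_mult_eq)
    moreover have "degree r = Polynomial.order l p"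
      unfolding r_def by (rule degree_linear_power)
    ultimately have deg: "degree q < degree p" using \<open>Polynomial.order l p > 0\<close> by simp
    have "coprime r q"
      using \<open>r \<noteq> 0\<close> q(2) by (intro coprime_poly_complexI) (auto simp: r_def poly_eq_0_iff_dvd)
    then obtain a b where ab: "z = poly_act D a z + poly_act D b z"
      "poly_act D r (poly_act D a z) = 0" "poly_act D q (poly_act D b z) = 0"
      using poly_act_coprime_split[of r q z] less.prems(3) unfolding q(1)[symmetric] by blast
    have in_V: "poly_act D s z \<in> V \<times> V" for s by (rule poly_act_in[OF V inv less.prems(1)])
    have "poly_act D a z \<in> generalized_eigenspace V D l"
      using ab(2) in_V unfolding mem_generalized_eigenspace_iff r_def by blast
    \<comment> \<open>A root of \<open>p\<close> is not necessarily an eigenvalue; if it is not, the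
      part belonging to it is \<open>0\<close> and lies in the span anyway.\<close>
    then have "poly_act D a z \<in> span (\<Union>l\<in>{l. eigenvalue_on V D l}. generalized_eigenspace V D l)"
      using eigenvalue_of_generalized_eigenvector[OF V inv, of "poly_act D a z" l]
      by (cases "poly_act D a z = 0") (auto simp: span_zero intro!: span_base)
    moreover have "poly_act D b z \<in> span (\<Union>l\<in>{l. eigenvalue_on V D l}. generalized_eigenspace V D l)"
      by (rule less.hyps[OF deg in_V \<open>q \<noteq> 0\<close> ab(3)])
    ultimately show ?thesis by (subst ab(1)) (rule span_add)
  qed
qed

section \<open>Annihilating polynomials of real vectors\<close>

lemma poly_act_of_real:
  "poly_act D (map_poly of_real p) (x, 0) = ((\<Sum>i\<le>degree p. coeff p i *\<^sub>R (D ^^ i) x), 0)"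
proof (induction p)
  case 0
  then show ?case by (simp add: zero_prod_def)
next
  case (pCons a p)
  show ?case
  proof (cases "p = 0")
    case True
    then show ?thesis using linear_0[OF D]
      by (simp add: map_poly_pCons cscale_def zero_prod_def)
  next
    case False
    then show ?thesis
      using pCons linear_0[OF D]
      by (simp add: map_poly_pCons cscale_def sum.atMost_Suc_shift linear_sum[OF D] linear_scale[OF D]
          del: sum.atMost_Suc)
  qed
qed

text \<open>A dimension count along one orbit: the iterates of \<open>x\<close> with exponents up to
  \<open>n = card B\<close> are \<open>n + 1\<close> vectors in the span of
  \<open>n\<close>.\<close>

lemma exists_annihilating_poly:
  assumes inv: "D ` V \<subseteq> V" and fin: "finite B" "V \<subseteq> span B" and x: "x \<in> V"
  shows "\<exists>p. p \<noteq> 0 \<and> poly_act D p (x, 0) = 0"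
proof -
  have orbit: "(D ^^ i) x \<in> V" for i by (induction i) (use x inv in auto)
  define n where "n = card B"
  have "\<exists>p::real poly. p \<noteq> 0 \<and> (\<Sum>i\<le>degree p. coeff p i *\<^sub>R (D ^^ i) x) = 0"
  \<comment> \<open>\<open>dependent\<close> speaks of sets and does not see repetitions, so
    coinciding iterates are treated apart, by a difference of two monomials.\<close>
  proof (cases "inj_on (\<lambda>i. (D ^^ i) x) {..n}")
    case False
    then obtain a b where "(D ^^ a) x = (D ^^ b) x" "a \<noteq> b" by (auto simp: inj_on_def)
    then obtain i j where ij: "(D ^^ i) x = (D ^^ j) x" "i < j" by (metis linorder_neqE_nat)
    define p :: "real poly" where "p = monom 1 j - monom 1 i"
    have coeff: "coeff p k = (if k = j then 1 else 0) - (if k = i then 1 else 0)" for k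
      by (simp add: p_def)
    have "coeff p j = 1" using ij by (simp add: coeff)
    then have "p \<noteq> 0" by auto
    have deg: "degree p = j"
    proof (rule antisym)
      show "degree p \<le> j" using ij(2) by (intro degree_le) (auto simp: coeff)
      show "j \<le> degree p" using \<open>coeff p j = 1\<close> by (intro le_degree) simp
    qed
    have "(\<Sum>k\<le>j. coeff p k *\<^sub>R (D ^^ k) x) = (D ^^ j) x - (D ^^ i) x"
    proof -
      have "coeff p k *\<^sub>R (D ^^ k) x =
          (if k = j then (D ^^ k) x else 0) - (if k = i then (D ^^ k) x else 0)" for k
        by (simp add: coeff)
      then show ?thesis using ij(2) by (simp add: sum_subtractf)
    qed
    then show ?thesis using \<open>p \<noteq> 0\<close> deg ij(1) by (intro exI[of _ p]) simp
  next
    case True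
    let ?S = "(\<lambda>i. (D ^^ i) x) ` {..n}"
    have "card ?S = Suc n" by (simp add: card_image[OF True])
    moreover have "?S \<subseteq> span B" using orbit fin(2) by auto
    ultimately have "dependent ?S"
      using independent_span_bound[OF fin(1), of ?S] by (auto simp: n_def)
    then obtain u y where u: "y \<in> ?S" "u y \<noteq> 0" "(\<Sum>v\<in>?S. u v *\<^sub>R v) = 0"
      using dependent_finite[of ?S] by blast
    \<comment> \<open>The coefficients \<open>u\<close> are indexed by vectors; injectivity of the
      iterates turns them into coefficients of a polynomial.\<close>
    define p :: "real poly" where "p = (\<Sum>i\<le>n. monom (u ((D ^^ i) x)) i)"
    have coeff: "coeff p k = (if k \<le> n then u ((D ^^ k) x) else 0)" for k
      by (simp add: p_def coeff_sum)
    obtain i where "i \<le> n" "y = (D ^^ i) x" using u(1) by auto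
    then have "coeff p i \<noteq> 0" using u(2) coeff by simp
    then have "p \<noteq> 0" by auto
    have "(\<Sum>i\<le>degree p. coeff p i *\<^sub>R (D ^^ i) x) = (\<Sum>i\<le>n. coeff p i *\<^sub>R (D ^^ i) x)"
    proof (rule sum.mono_neutral_left)
      have "degree p \<le> n" by (intro degree_le) (simp add: coeff)
      then show "{..degree p} \<subseteq> {..n}" by simp
    qed (auto simp: coeff_eq_0)
    also have "\<dots> = (\<Sum>v\<in>?S. u v *\<^sub>R v)"
      by (simp add: sum.reindex[OF True] coeff)
    finally have "(\<Sum>i\<le>degree p. coeff p i *\<^sub>R (D ^^ i) x) = 0" using u(3) by (rule trans)
    then show ?thesis using \<open>p \<noteq> 0\<close> by blast
  qed
  then obtain p :: "real poly" where "p \<noteq> 0" "(\<Sum>i\<le>degree p. coeff p i *\<^sub>R (D ^^ i) x) = 0" by blast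
  then have "map_poly complex_of_real p \<noteq> 0 \<and> poly_act D (map_poly complex_of_real p) (x, 0) = 0"
    by (simp add: poly_act_of_real map_poly_eq_0_iff zero_prod_def)
  then show ?thesis by blast
qed

text \<open>If \<open>(u, w)\<close> is a generalized eigenvector for \<open>l\<close> then \<open>(u, - w)\<close> is one for the
  complex conjugate of \<open>l\<close>, and \<open>2 u\<close> is their sum.\<close>

lemma real_generalized_eigenspace_annihilated:
  assumes "x \<in> real_generalized_eigenspace V D l"
  shows "\<exists>n. poly_act D (([:- l, 1:] * [:- cnj l, 1:]) ^ n) (x, 0) = 0"
proof -
  from assms obtain w n where w: "poly_act D ([:- l, 1:] ^ n) (x, w) = 0"
    by (auto simp: real_generalized_eigenspace_def mem_generalized_eigenspace_iff)
  have conj: "((\<lambda>y. map_prod D D y - cscale (cnj l) y) ^^ n) (apsnd uminus z) =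
      apsnd uminus (((\<lambda>y. map_prod D D y - cscale l y) ^^ n) z)" for n z
    by (induction n)
      (auto simp: cscale_def map_prod_def linear_neg[OF D] split: prod.splits)
  have w': "poly_act D ([:- cnj l, 1:] ^ n) (x, - w) = 0"
    using conj[of n "(x, w)"] w by (simp add: poly_act_power_linear_factor zero_prod_def)
  let ?p = "([:- l, 1:] * [:- cnj l, 1:]) ^ n"
  have "poly_act D ?p (x, w) = 0"
    using w by (simp only: power_mult_distrib poly_act_mult_eq_0 simp_thms)
  moreover have "poly_act D ?p (x, - w) = 0"
    using w' by (simp only: power_mult_distrib poly_act_mult_eq_0 simp_thms)
  ultimately have "poly_act D ?p ((1/2) *\<^sub>R ((x, w) + (x, - w))) = 0"
    by (simp only: linear_scale[OF linear_poly_act] linear_add[OF linear_poly_act]) simp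
  moreover have "(1/2) *\<^sub>R ((x, w) + (x, - w)) = (x, 0)" by simp
  ultimately show ?thesis by metis
qed

text \<open>Only the location of the roots is recorded. Conjugation preserves the sign of the real
  part, so \<open>P\<close> can be such a sign, and a product of annihilators has no roots beyond
  those of its factors.\<close>

lemma span_real_generalized_eigenspaces_annihilated:
  assumes "x \<in> span (\<Union>l\<in>L. real_generalized_eigenspace V D l)"
    and conj: "\<And>l. l \<in> L \<Longrightarrow> P l \<and> P (cnj l)"
  shows "\<exists>p. p \<noteq> 0 \<and> (\<forall>l. poly p l = 0 \<longrightarrow> P l) \<and> poly_act D p (x, 0) = 0"
  using assms(1)
proof (induction rule: span_induct_alt)
  case base
  show ?case
    \<comment> \<open>The zero vector is killed by \<open>1\<close>, which has no roots.\<close>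
    by (rule exI[of _ 1]) (simp add: zero_prod_def)
next
  case (step c x y)
  then obtain l n where l: "l \<in> L" "poly_act D (([:- l, 1:] * [:- cnj l, 1:]) ^ n) (x, 0) = 0"
    using real_generalized_eigenspace_annihilated by blast
  from step obtain p where p: "p \<noteq> 0" "\<forall>l. poly p l = 0 \<longrightarrow> P l" "poly_act D p (y, 0) = 0"
    by blast
  let ?q = "([:- l, 1:] * [:- cnj l, 1:]) ^ n"
  have "poly_act D (?q * p) (x, 0) = 0"
    using l(2) by (intro poly_act_mult_eq_0) blast
  moreover have "poly_act D (?q * p) (y, 0) = 0"
    using p(3) by (intro poly_act_mult_eq_0) blast
  ultimately have "poly_act D (?q * p) (c *\<^sub>R (x, 0) + (y, 0)) = 0"
    by (simp only: linear_scale[OF linear_poly_act] linear_add[OF linear_poly_act]) simp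
  then have "poly_act D (?q * p) (c *\<^sub>R x + y, 0) = 0" by simp
  moreover have "?q * p \<noteq> 0" using p(1) by simp
  moreover have "P k" if "poly (?q * p) k = 0" for k
  proof -
    have "(k - l) * (k - cnj l) = 0 \<or> poly p k = 0" using that by (auto simp: algebra_simps)
    then have "k = l \<or> k = cnj l \<or> poly p k = 0" by simp
    then show ?thesis using conj[OF l(1)] p(2) by blast
  qed
  ultimately show ?case by blast
qed

text \<open>A common vector is killed by a polynomial with roots in the open right half-plane and by
  one with roots in the open left half-plane; these are coprime, so \<open>1\<close> kills
  it.\<close>

lemma unstable_stable_inter: "unstable_part V D \<inter> stable_part V D = {0}"
proof
  show "{0} \<subseteq> unstable_part V D \<inter> stable_part V D"
    by (simp add: unstable_part_def stable_part_def span_zero)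
  show "unstable_part V D \<inter> stable_part V D \<subseteq> {0}"
  proof
    fix x assume "x \<in> unstable_part V D \<inter> stable_part V D"
    then have x: "x \<in> unstable_part V D" "x \<in> stable_part V D" by auto
    obtain p where p: "p \<noteq> 0" "\<And>l. poly p l = 0 \<Longrightarrow> Re l > 0" "poly_act D p (x, 0) = 0"
      using span_real_generalized_eigenspaces_annihilated
          [OF x(1)[unfolded unstable_part_def], of "\<lambda>l. Re l > 0"] by auto
    obtain q where q: "q \<noteq> 0" "\<And>l. poly q l = 0 \<Longrightarrow> Re l < 0" "poly_act D q (x, 0) = 0"
      using span_real_generalized_eigenspaces_annihilated
          [OF x(2)[unfolded stable_part_def], of "\<lambda>l. Re l < 0"] by auto
    have "coprime p q" using p(1,2) q(2) by (intro coprime_poly_complexI) (auto dest: order_less_asym)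
    then obtain s t where st: "s * p + t * q = 1"
      using bezout_coefficients_fst_snd[of p q] unfolding coprime_imp_gcd_eq_1[OF \<open>coprime p q\<close>] by blast
    have "(x, 0) = poly_act D (s * p + t * q) (x, 0)" by (simp add: st)
    also have "\<dots> = 0"
      using p(3) q(3) linear_0[OF linear_poly_act] by (simp add: poly_act_add poly_act_mult)
    finally show "x \<in> {0}" by (simp add: zero_prod_def)
  qed
qed

lemma hyperbolic_decomposition:
  assumes V: "subspace V" and inv: "D ` V \<subseteq> V" and fin: "finite B" "V \<subseteq> span B"
    and hyp: "hyperbolic_on V D" and x: "x \<in> V"
  shows "\<exists>u\<in>unstable_part V D. \<exists>s\<in>stable_part V D. x = u + s"
proof -
  obtain p where "p \<noteq> 0" "poly_act D p (x, 0) = 0"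
    using exists_annihilating_poly[OF inv fin x] by blast
  then have "(x, 0) \<in> span (\<Union>l\<in>{l. eigenvalue_on V D l}. generalized_eigenspace V D l)"
    using primary_decomposition[OF V inv] x subspace_0[OF V] by blast
  \<comment> \<open>Phrased with \<open>fst\<close> because the induction runs over all pairs in the
    span, whose second components can be nonzero.\<close>
  then have "\<exists>u\<in>unstable_part V D. \<exists>s\<in>stable_part V D. fst (x, 0::'v) = u + s"
  proof (induction rule: span_induct_alt)
    case base
    show ?case
      by (intro bexI[of _ 0]) (auto simp: unstable_part_def stable_part_def span_zero)
  next
    case (step c z y)
    then obtain u s l where us: "u \<in> unstable_part V D" "s \<in> stable_part V D" "fst y = u + s"
      and l: "eigenvalue_on V D l" "z \<in> generalized_eigenspace V D l" by blast
    then have z: "fst z \<in> real_generalized_eigenspace V D l"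
      by (simp add: real_generalized_eigenspace_def)
    \<comment> \<open>Hyperbolicity enters here: each eigenvalue falls into one of the two
      half-planes.\<close>
    consider "Re l > 0" | "Re l < 0" using hyp l(1) by (meson hyperbolic_on_def linorder_neqE)
    then show ?case
    proof cases
      case 1
      then have "fst z \<in> unstable_part V D" unfolding unstable_part_def
        using l(1) z by (intro span_base) blast
      then have "c *\<^sub>R fst z + u \<in> unstable_part V D"
        using us(1) unfolding unstable_part_def by (intro span_add span_scale)
      then show ?thesis using us by (intro bexI[of _ "c *\<^sub>R fst z + u"] bexI[of _ s]) simp_all
    next
      case 2
      then have "fst z \<in> stable_part V D" unfolding stable_part_def
        using l(1) z by (intro span_base) blast
      then have "c *\<^sub>R fst z + s \<in> stable_part V D"
        using us(2) unfolding stable_part_def by (intro span_add span_scale)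
      then show ?thesis using us by (intro bexI[of _ "c *\<^sub>R fst z + s"] bexI[of _ u]) simp_all
    qed
  qed
  then show ?thesis by simp
qed

lemma span_real_generalized_eigenspaces_subset:
  assumes V: "subspace V"
  shows "span (\<Union>l\<in>L. real_generalized_eigenspace V D l) \<subseteq> V"
  by (intro span_minimal V) (auto simp: real_generalized_eigenspace_def generalized_eigenspace_def)

lemma span_real_generalized_eigenspaces_invariant:
  assumes inv: "D ` V \<subseteq> V"
  shows "D ` span (\<Union>l\<in>L. real_generalized_eigenspace V D l) \<subseteq>
    span (\<Union>l\<in>L. real_generalized_eigenspace V D l)"
proof -
  have "D (fst z) \<in> real_generalized_eigenspace V D l" if "z \<in> generalized_eigenspace V D l" for z l
  proof -
    from that obtain n where n: "z \<in> V \<times> V" "poly_act D ([:- l, 1:] ^ n) z = 0"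
      by (auto simp: mem_generalized_eigenspace_iff)
    \<comment> \<open>As the action of the polynomial \<open>[:0, 1:]\<close>, the complexified map
      commutes with every power of \<open>[:- l, 1:]\<close>.\<close>
    have *: "map_prod D D z = poly_act D [:0, 1:] z"
      using linear_0[OF linear_map_prod[OF D]] by simp
    have "poly_act D ([:- l, 1:] ^ n) (map_prod D D z) = 0"
      using n(2) unfolding * poly_act_mult[symmetric]
      by (subst mult.commute) (intro poly_act_mult_eq_0 disjI2)
    moreover have "map_prod D D z \<in> V \<times> V" using n(1) inv by (cases z) auto
    ultimately have "map_prod D D z \<in> generalized_eigenspace V D l"
      unfolding mem_generalized_eigenspace_iff by blast
    then show ?thesis unfolding real_generalized_eigenspace_def
      by (metis fst_map_prod imageI)
  qed
  then show ?thesis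
    unfolding linear_span_image[OF D, symmetric]
    by (intro span_mono) (auto simp: real_generalized_eigenspace_def)
qed

end

section \<open>Linear extension, congruence and orbit spans\<close>

section \<open>Orbit spans\<close>

text \<open>The polynomial calculus asks for a map linear on the whole type, while the derivation is
  linear on the Lie algebra; its values on a basis of \<open>V\<close> determine the extension on
  \<open>V\<close>.\<close>

lemma exists_linear_extension:
  fixes D :: "'v::real_vector \<Rightarrow> 'w::real_vector"
  assumes V: "subspace V"
    and add: "\<And>x y. x \<in> V \<Longrightarrow> y \<in> V \<Longrightarrow> D (x + y) = D x + D y"
    and scale: "\<And>c x. x \<in> V \<Longrightarrow> D (c *\<^sub>R x) = c *\<^sub>R D x"
  obtains D' where "linear D'" "\<And>x. x \<in> V \<Longrightarrow> D' x = D x"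
proof -
  obtain B where B: "B \<subseteq> V" "independent B" "span B = V"
    using basis_exists[of V] span_subspace[OF _ _ V] by metis
  obtain D' where D': "linear D'" "\<And>x. x \<in> B \<Longrightarrow> D' x = D x"
    using linear_independent_extend[OF B(2), of D] by blast
  \<comment> \<open>Membership in \<open>V\<close> is carried through the induction because the
    rules for \<open>D\<close> apply only there.\<close>
  have "D' x = D x \<and> x \<in> V" if "x \<in> span B" for x
    using that
  proof (induction rule: span_induct_alt)
    case base
    show ?case using scale[OF subspace_0[OF V], of 0] linear_0[OF D'(1)] subspace_0[OF V] by simp
  next
    case (step c x y)
    then have "x \<in> V" using B(1) by blast
    then show ?case
      using step D' add[OF subspace_scale[OF V, of x c], of y] scale[of x c]
        subspace_add[OF V subspace_scale[OF V, of x c], of y]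
      by (simp add: linear_add linear_scale)
  qed
  then show thesis using that[OF D'(1)] B(3) by blast
qed

lemma funpow_eq_on_invariant:
  assumes "f ` W \<subseteq> W" "\<And>x. x \<in> W \<Longrightarrow> g x = f x" "x \<in> W"
  shows "(g ^^ k) x = (f ^^ k) x \<and> (f ^^ k) x \<in> W"
proof (induction k)
  case (Suc k)
  then show ?case using assms(1,2) by auto
qed (simp add: assms(3))

text \<open>This replaces by the linear extension both \<open>D\<close> and
  \<open>restrict D P\<close>, the latter being \<open>undefined\<close> off \<open>P\<close>.
  Invariance of \<open>W\<close> keeps all iterates where the maps agree.\<close>

lemma orbit_span_cong:
  assumes "f ` W \<subseteq> W" "\<And>x. x \<in> W \<Longrightarrow> g x = f x" "H \<subseteq> W"
  shows "orbit_span g H = orbit_span f H"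
proof -
  have "(g ^^ k) x = (f ^^ k) x" if "x \<in> H" for k x
    using funpow_eq_on_invariant[of f W g x k] assms that by auto
  then have "{(g ^^ k) x | k x. x \<in> H} = {(f ^^ k) x | k x. x \<in> H}" by metis
  then show ?thesis by (simp add: orbit_span_def)
qed

lemma eigenvalue_on_cong:
  assumes "\<And>x. x \<in> V \<Longrightarrow> g x = f x"
  shows "eigenvalue_on V g l = eigenvalue_on V f l"
proof -
  have "map_prod g g z = map_prod f f z" if "z \<in> V \<times> V" for z
    using that assms by (cases z) simp
  then show ?thesis unfolding eigenvalue_on_def by (intro bex_cong refl) simp
qed

text \<open>The iterates of \<open>f - l\<close> stay in \<open>V \<times> V\<close>, so agreement
  on \<open>V\<close> decides all of them.\<close>

lemma generalized_eigenspace_cong: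
  assumes V: "subspace V" and inv: "f ` V \<subseteq> V" and eq: "\<And>x. x \<in> V \<Longrightarrow> g x = f x"
  shows "generalized_eigenspace V g l = generalized_eigenspace V f l"
proof -
  let ?F = "\<lambda>y. map_prod f f y - cscale l y"
  have cs: "cscale l z \<in> V \<times> V" if "z \<in> V \<times> V" for z
    using that by (cases z) (auto simp: cscale_def intro!: subspace_add[OF V] subspace_diff[OF V] subspace_scale[OF V])
  have invF: "?F ` (V \<times> V) \<subseteq> V \<times> V"
  proof (rule image_subsetI)
    fix z assume z: "z \<in> V \<times> V"
    have "map_prod f f z \<in> V \<times> V" using z inv by (cases z) auto
    with cs[OF z] show "?F z \<in> V \<times> V"
      by (cases "map_prod f f z"; cases "cscale l z") (simp add: subspace_diff[OF V])
  qed
  have eqF: "map_prod g g z - cscale l z = ?F z" if "z \<in> V \<times> V" for z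
    using that eq by (cases z) simp
  have "((\<lambda>y. map_prod g g y - cscale l y) ^^ n) z = (?F ^^ n) z" if "z \<in> V \<times> V" for n z
    by (rule funpow_eq_on_invariant[OF invF eqF that, THEN conjunct1])
  then show ?thesis unfolding generalized_eigenspace_def by (intro Collect_cong conj_cong refl) simp
qed

text \<open>Directness is inherited from \<open>P\<close> and \<open>M\<close>, which contain the
  two orbit spans.\<close>

lemma orbit_span_direct_sum:
  fixes D :: "'v::real_vector \<Rightarrow> 'v"
  assumes D: "linear D" and P: "subspace P" "D ` P \<subseteq> P" "Hp \<subseteq> P"
    and M: "subspace M" "D ` M \<subseteq> M" "Hm \<subseteq> M"
    and PM: "P \<inter> M = {0}" and H: "direct_sum H Hp Hm"
  shows "direct_sum (orbit_span D H) (orbit_span D Hp) (orbit_span D Hm)"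
    and "orbit_span D Hp \<subseteq> P" "orbit_span D Hm \<subseteq> M"
proof -
  have sub: "orbit_span D K \<subseteq> W" if "subspace W" "D ` W \<subseteq> W" "K \<subseteq> W" for K W
    unfolding orbit_span_def
  proof (rule span_minimal[OF _ that(1)])
    show "{(D ^^ k) Y |k Y. Y \<in> K} \<subseteq> W"
      using funpow_eq_on_invariant[OF that(2), of D] that(3) by blast
  qed
  show p: "orbit_span D Hp \<subseteq> P" and m: "orbit_span D Hm \<subseteq> M" by (rule sub[OF P], rule sub[OF M])
  \<comment> \<open>The intersection being \<open>{0}\<close> puts \<open>0\<close> into both
    summands, whence both are contained in \<open>H\<close>.\<close>
  have zero: "0 \<in> Hp" "0 \<in> Hm" and H_eq: "H = {u + v | u v. u \<in> Hp \<and> v \<in> Hm}"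
    using H by (auto simp: direct_sum_def)
  have pow_add: "(D ^^ k) (x + y) = (D ^^ k) x + (D ^^ k) y" for k x y
    by (induction k) (simp_all add: linear_add[OF D])
  let ?S = "{u + v | u v. u \<in> orbit_span D Hp \<and> v \<in> orbit_span D Hm}"
  have "orbit_span D H \<subseteq> ?S"
    unfolding orbit_span_def[of D H]
  proof (rule span_minimal)
    show "subspace ?S" unfolding orbit_span_def by (intro subspace_sums subspace_span)
    show "{(D ^^ k) Y |k Y. Y \<in> H} \<subseteq> ?S"
    proof
      fix z assume "z \<in> {(D ^^ k) Y |k Y. Y \<in> H}"
      then obtain k x y where z: "z = (D ^^ k) x + (D ^^ k) y" and xy: "x \<in> Hp" "y \<in> Hm"
        by (auto simp: H_eq pow_add)
      have "(D ^^ k) x \<in> orbit_span D Hp" "(D ^^ k) y \<in> orbit_span D Hm"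
        unfolding orbit_span_def using xy by (blast intro: span_base)+
      then show "z \<in> ?S" using z by blast
    qed
  qed
  moreover have "?S \<subseteq> orbit_span D H"
  proof -
    have "Hp \<subseteq> H" "Hm \<subseteq> H" using zero unfolding H_eq by force+
    then have "orbit_span D Hp \<subseteq> orbit_span D H" "orbit_span D Hm \<subseteq> orbit_span D H"
      unfolding orbit_span_def by (intro span_mono; blast)+
    then show ?thesis unfolding orbit_span_def by (blast intro: span_add)
  qed
  moreover have "orbit_span D Hp \<inter> orbit_span D Hm = {0}"
    using p m PM by (auto simp: orbit_span_def span_zero)
  ultimately show "direct_sum (orbit_span D H) (orbit_span D Hp) (orbit_span D Hm)"
    by (simp add: direct_sum_def)
qed

text \<open>The linear algebra of the theorem, with the Lie algebra replaced by a subspace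
  \<open>V\<close> inside a finite span and with \<open>D\<close> linear on
  \<open>V\<close>.\<close>

lemma hyperbolic_orbit_span:
  fixes D :: "'v::real_vector \<Rightarrow> 'v"
  assumes V: "subspace V" and inv: "D ` V \<subseteq> V" and fin: "finite B" "V \<subseteq> span B"
    and add: "\<And>x y. x \<in> V \<Longrightarrow> y \<in> V \<Longrightarrow> D (x + y) = D x + D y"
    and scale: "\<And>c x. x \<in> V \<Longrightarrow> D (c *\<^sub>R x) = c *\<^sub>R D x"
    and hyp: "hyperbolic_on V D"
    and P: "P = unstable_part V D" and M: "M = stable_part V D"
    and Hp: "Hp \<subseteq> P" and Hm: "Hm \<subseteq> M" and H: "direct_sum H Hp Hm"
  shows "direct_sum (orbit_span D H) (orbit_span (restrict D P) Hp) (orbit_span (restrict D M) Hm) \<and>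
    (orbit_span D H = V \<longleftrightarrow> orbit_span (restrict D P) Hp = P \<and> orbit_span (restrict D M) Hm = M)"
proof -
  obtain D' where D': "linear D'" and eq: "\<And>x. x \<in> V \<Longrightarrow> D' x = D x"
    using exists_linear_extension[OF V add scale] by blast
  have inv': "D' ` V \<subseteq> V" using inv eq by auto
  \<comment> \<open>The spectral notions see \<open>D\<close> only on \<open>V\<close>, so they may
    be computed with \<open>D'\<close>.\<close>
  note ev = eigenvalue_on_cong[where g = D' and f = D, OF eq]
    and ge = generalized_eigenspace_cong[where g = D' and f = D, OF V inv eq]
  have P': "P = unstable_part V D'" and M': "M = stable_part V D'" and hyp': "hyperbolic_on V D'"
    using hyp unfolding P M unstable_part_def stable_part_def hyperbolic_on_def
      real_generalized_eigenspace_def by (simp_all add: ev ge)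
  have PV: "P \<subseteq> V" "M \<subseteq> V"
    unfolding P' M' unstable_part_def stable_part_def
    by (rule span_real_generalized_eigenspaces_subset[OF D' V])+
  have subP: "subspace P" "subspace M"
    unfolding P' M' unstable_part_def stable_part_def by (rule subspace_span)+
  have invP: "D' ` P \<subseteq> P" "D' ` M \<subseteq> M"
    unfolding P' M' unstable_part_def stable_part_def
    by (rule span_real_generalized_eigenspaces_invariant[OF D' inv'])+
  have PM: "P \<inter> M = {0}" unfolding P' M' by (rule unstable_stable_inter[OF D'])
  have decomp: "\<exists>u\<in>P. \<exists>s\<in>M. x = u + s" if "x \<in> V" for x
    unfolding P' M' by (rule hyperbolic_decomposition[OF D' V inv' fin hyp' that])
  note sum = orbit_span_direct_sum[OF D' subP(1) invP(1) Hp subP(2) invP(2) Hm PM H]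
  have "H \<subseteq> V"
    using H Hp Hm PV subspace_add[OF V] unfolding direct_sum_def by blast
  then have orbH: "orbit_span D H = orbit_span D' H"
    using eq by (intro orbit_span_cong[OF inv']) auto
  have orbP: "orbit_span (restrict D P) Hp = orbit_span D' Hp"
    using eq PV by (intro orbit_span_cong[OF invP(1) _ Hp]) auto
  have orbM: "orbit_span (restrict D M) Hm = orbit_span D' Hm"
    using eq PV by (intro orbit_span_cong[OF invP(2) _ Hm]) auto
  let ?OP = "orbit_span D' Hp" and ?OM = "orbit_span D' Hm"
  have OH: "orbit_span D' H = {u + v | u v. u \<in> ?OP \<and> v \<in> ?OM}"
    using sum(1) by (simp add: direct_sum_def)
  have "orbit_span D' H = V \<longleftrightarrow> ?OP = P \<and> ?OM = M"
  proof
    assume full: "orbit_span D' H = V"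
    \<comment> \<open>The summand of \<open>x\<close> in \<open>M\<close> is a difference of two
      elements of \<open>P\<close>, hence \<open>0\<close>.\<close>
    have split: "x \<in> ?OP" if x: "x \<in> P" for x
    proof -
      have "x \<in> orbit_span D' H" using x PV full by blast
      then obtain a b where ab: "x = a + b" "a \<in> ?OP" "b \<in> ?OM" unfolding OH by blast
      then have "b = x - a" by simp
      then have "b \<in> P" using subspace_diff[OF subP(1)] x ab(2) sum(2) by blast
      then have "b = 0" using PM ab(3) sum(3) by blast
      then show ?thesis using ab by simp
    qed
    have split': "x \<in> ?OM" if x: "x \<in> M" for x
    proof -
      have "x \<in> orbit_span D' H" using x PV full by blast
      then obtain a b where ab: "x = a + b" "a \<in> ?OP" "b \<in> ?OM" unfolding OH by blast
      then have "a = x - b" by simp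
      then have "a \<in> M" using subspace_diff[OF subP(2)] x ab(3) sum(3) by blast
      then have "a = 0" using PM ab(2) sum(2) by blast
      then show ?thesis using ab by simp
    qed
    show "?OP = P \<and> ?OM = M" using split split' sum(2,3) by blast
  next
    \<comment> \<open>The orbit span is now the sum of \<open>P\<close> and \<open>M\<close>, which
      is all of \<open>V\<close> by \<open>decomp\<close>.\<close>
    assume "?OP = P \<and> ?OM = M"
    then show "orbit_span D' H = V"
      unfolding OH using decomp PV subspace_add[OF V] by blast
  qed
  then show ?thesis unfolding orbH orbP orbM using sum(1) by blast
qed

theorem proposition4p1:
  fixes G :: "'g::{t2_space,second_countable_topology} monoid"
    and A :: "('g, 'e::real_inner) chart set"
    and X :: "'g operator"
    and Xp Xm :: "nat \<Rightarrow> 'g operator" and mp mm :: nat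
    and \<gg> \<gg>p \<gg>m \<hh> \<hh>p \<hh>m :: "'g operator set"
    and D Dp Dm :: "'g operator \<Rightarrow> 'g operator"
  assumes "lie_group G A"
    and "connected (UNIV :: 'g set)"
    and "solvable G"
    and "\<gg> = lie_algebra G A"
    and "linear_vector_field G A X"
    and "D = derivation_of X"
    and "hyperbolic_on \<gg> D"
    and "\<gg>p = unstable_part \<gg> D"
    and "\<gg>m = stable_part \<gg> D"
    and "Dp = restrict D \<gg>p"
    and "Dm = restrict D \<gg>m"
    and "\<forall>i\<in>{1..mp}. Xp i \<in> \<gg> \<and> Xp i \<in> \<gg>p"
    and "\<forall>j\<in>{1..mm}. Xm j \<in> \<gg> \<and> Xm j \<in> \<gg>m"
    and "\<hh>p = lie_generated G A (Xp ` {1..mp})"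
    and "\<hh>m = lie_generated G A (Xm ` {1..mm})"
    and "direct_sum \<hh> \<hh>p \<hh>m"
    and "\<hh>p \<subseteq> \<gg>p"
    and "\<hh>m \<subseteq> \<gg>m"
  shows "direct_sum (orbit_span D \<hh>) (orbit_span Dp \<hh>p) (orbit_span Dm \<hh>m) \<and>
    (orbit_span D \<hh> = \<gg> \<longleftrightarrow> orbit_span Dp \<hh>p = \<gg>p \<and> orbit_span Dm \<hh>m = \<gg>m)"
proof -
  interpret lie_group G A by fact
  obtain \<Phi> where X: "vector_field A X" "flow_of A X \<Phi>" "\<And>t. \<Phi> t \<in> lie_automorphisms G A"
    using \<open>linear_vector_field G A X\<close> unfolding linear_vector_field_def by blast
  obtain B where B: "finite B" "lie_algebra G A \<subseteq> span B" using lie_algebra_finite_dim by blast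
  have vf: "vector_field A Y" if "Y \<in> \<gg>" for Y
    using that \<open>\<gg> = lie_algebra G A\<close> lie_algebra_vector_field by blast
  show ?thesis
    unfolding \<open>Dp = restrict D \<gg>p\<close> \<open>Dm = restrict D \<gg>m\<close>
  \<comment> \<open>The group enters the linear algebra through four facts: its Lie algebra is a
    subspace, lies in a finite span, is invariant under \<open>D\<close>, and \<open>D\<close> is
    linear on it.\<close>
  proof (rule hyperbolic_orbit_span[where B = B and V = \<gg> and P = \<gg>p and M = \<gg>m])
    show "subspace \<gg>" unfolding \<open>\<gg> = lie_algebra G A\<close> by (rule subspace_lie_algebra[OF atlas])
    show "D ` \<gg> \<subseteq> \<gg>"
      unfolding \<open>\<gg> = lie_algebra G A\<close> \<open>D = derivation_of X\<close>
      by (intro image_subsetI derivation_lie_algebra[OF X])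
    show "\<gg> \<subseteq> span B" unfolding \<open>\<gg> = lie_algebra G A\<close> by (rule B(2))
    show "D (Y + Z) = D Y + D Z" if "Y \<in> \<gg>" "Z \<in> \<gg>" for Y Z
      unfolding \<open>D = derivation_of X\<close> by (rule derivation_of_add[OF charted X(1) vf[OF that(1)] vf[OF that(2)]])
    show "D (c *\<^sub>R Y) = c *\<^sub>R D Y" if "Y \<in> \<gg>" for c Y
      unfolding \<open>D = derivation_of X\<close> by (rule derivation_of_scaleR[OF charted X(1) vf[OF that]])
  qed fact+
qed

end
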